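(* Let $F$ be a free group of finite rank with fixed basis $A$, let $H$ be a finitely generated subgroup of $F$, and let $H_{\mathsf{fi}}$ be the maximum finite-index extension of $H$, i.e. the largest subgroup of $F$ that contains $H$ as a subgroup of finite index. Then: \begin{enumerate} \item $\mathcal{A}(H_{\mathsf{fi}})$ is obtained from $\mathcal{A}(H)$ by identifying all pairs of vertices $p,q$ of $\mathsf{cc}(\Gamma(H))$ such that $L_p(H)=L_q(H)$; no reduction is necessary (the quotient graph is already reduced). \item $H_{\mathsf{fi}}=\mathrm{Comm}_F(H)$. \end{enumerate}
   Context: Words: $F$ is a free group with finite basis $A$; $\bar A=\{\bar a: a\in A\}$ is a disjoint copy of $A$ and $\tilde A=A\cup\bar A$, with $\bar{\bar a}=a$ and $\overline{ua}=\bar a\,\bar u$. Elements of $F$ are identified with reduced words over $\tilde A$ (no factor $a\bar a$, $a\in\tilde A$). Stallings graph: each finitely generated $H\le F$ has a unique representation $\mathcal{A}(H)=(\Gamma(H),1)$, where $\Gamma(H)$ is a finite connected directed graph with edges labeled by $A$ and $1$ is a designated vertex, such that (i) for each $a\in A$ every vertex is the source of at most one and the target of at most one $a$-labeled edge (the graph is "reduced"); (ii) every vertex except possibly $1$ has degree (in-degree plus out-degree) at least $2$; (iii) a reduced word is in $H$ iff it labels a loop at $1$. Here an edge $(p,a,q)$, $a\in A$, is read as $p\xrightarrow{a}q$ and $q\xrightarrow{\bar a}p$, so paths are labeled by words over $\tilde A$. Core: $H$ is called cyclically reduced if every vertex of $\Gamma(H)$ has degree at least $2$; in that case $\mathsf{cc}(\Gamma(H))=\Gamma(H)$.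 If $H$ is not cyclically reduced, then vertex $1$ has degree $1$ and $\Gamma(H)$ consists of two parts: the tail, which contains $1$ and all degree-$2$ vertices that can be connected to $1$ through other degree-$2$ vertices, and the rest of $\Gamma(H)$, which is the core $\mathsf{cc}(\Gamma(H))$. Languages: for a vertex $p$ of $\mathsf{cc}(\Gamma(H))$, $L_p(H)$ is the set of reduced words over $\tilde A$ labeling a path in $\mathsf{cc}(\Gamma(H))$ starting at $p$. Finite-index extensions: a finite-index extension of $H$ is a subgroup $G\le F$ with $H\le G$ and $[G:H]<\infty$. The maximum finite-index extension of $H$ is denoted $H_{\mathsf{fi}}$. Commensurator: $\mathrm{Comm}_F(H)$ is the set of all $g\in F$ such that $H\cap H^g$ has finite index in both $H$ and $H^g$, where $H^g=g^{-1}Hg$.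
   Formalization: Part 2, H_fi = Comm_F(H), is stated only when H is nontrivial or A is empty: for H = {1} and A nonempty it is false, since F is torsion-free so H_fi = {1}, while Comm_F({1}) = F. Part 1 is stated for all finitely generated H. *)

theory Defs
  imports "HOL-Algebra.Generated_Groups"
begin

section \<open>The free group on a set\<close>

text \<open>A word over \<open>A\<close> and its disjoint copy is a list over the disjoint sum \<open>A <+> A\<close>:
  \<open>Inl a\<close> is the letter \<open>a\<close>, and \<open>Inr a\<close> is its formal inverse.\<close>

type_synonym 'a gword = "('a + 'a) list"

fun bar :: "'a + 'a \<Rightarrow> 'a + 'a" where
  "bar (Inl a) = Inr a"
| "bar (Inr a) = Inl a"

definition reduced :: "'a gword \<Rightarrow> bool" where
  "reduced w \<longleftrightarrow> successively (\<lambda>x y. y \<noteq> bar x) w"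

fun rcons :: "'a + 'a \<Rightarrow> 'a gword \<Rightarrow> 'a gword" where
  "rcons x [] = [x]"
| "rcons x (y # w) = (if y = bar x then w else x # y # w)"

definition free_reduce :: "'a gword \<Rightarrow> 'a gword" where
  "free_reduce w = foldr rcons w []"

definition free_group :: "'a set \<Rightarrow> 'a gword monoid" where
  "free_group A =
     \<lparr>carrier = {w \<in> lists (A <+> A). reduced w},
      monoid.mult = (\<lambda>u v. free_reduce (u @ v)),
      monoid.one = []\<rparr>"

lemma bar_bar [simp]: "bar (bar x) = x"
  by (cases x) auto

lemma bar_eq_iff [simp]: "bar x = bar y \<longleftrightarrow> x = y"
  by (metis bar_bar)

lemma bar_mem [simp]: "bar x \<in> A <+> A \<longleftrightarrow> x \<in> A <+> A"
  by (cases x) auto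

lemma reduced_Nil [simp]: "reduced []"
  by (simp add: reduced_def)

lemma reduced_ConsD: "reduced (x # w) \<Longrightarrow> reduced w"
  by (cases w) (auto simp: reduced_def)

lemma reduced_rcons: "reduced w \<Longrightarrow> reduced (rcons x w)"
  by (cases w) (auto simp: reduced_def reduced_ConsD[unfolded reduced_def])

lemma reduced_foldr_rcons: "reduced w \<Longrightarrow> reduced (foldr rcons u w)"
  by (induction u) (auto intro: reduced_rcons)

lemma rcons_bar_rcons: "reduced w \<Longrightarrow> rcons (bar x) (rcons x w) = w"
  by (cases w rule: remdups_adj.cases) (auto simp: reduced_def)

lemma rcons_reduced: "reduced (x # w) \<Longrightarrow> rcons x w = x # w"
  by (cases w) (auto simp: reduced_def)

lemma free_reduce_reduced: "reduced w \<Longrightarrow> free_reduce w = w"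
proof (induction w)
  case (Cons x w)
  then show ?case
    using reduced_ConsD[of x w] rcons_reduced[of x w] by (simp add: free_reduce_def)
qed (simp add: free_reduce_def)

lemma foldr_rcons_rcons:
  assumes "reduced w"
  shows "foldr rcons (rcons x u) w = rcons x (foldr rcons u w)"
proof (cases u)
  case (Cons y v)
  then show ?thesis
    using rcons_bar_rcons[OF reduced_foldr_rcons[OF assms], of "bar x" v] by simp
qed simp

lemma foldr_rcons_free_reduce:
  "reduced w \<Longrightarrow> foldr rcons (free_reduce u) w = foldr rcons u w"
  by (induction u) (auto simp: free_reduce_def foldr_rcons_rcons)

lemma rcons_in_lists: "x \<in> S \<Longrightarrow> w \<in> lists S \<Longrightarrow> rcons x w \<in> lists S"
  by (cases w) auto

lemma free_reduce_in_lists: "w \<in> lists S \<Longrightarrow> free_reduce w \<in> lists S"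
  unfolding free_reduce_def
  by (induction w) (simp_all add: rcons_in_lists del: in_lists_conv_set)

lemma reduced_free_reduce: "reduced (free_reduce w)"
  by (simp add: free_reduce_def reduced_foldr_rcons)

lemma foldr_rcons_inverse:
  "reduced w \<Longrightarrow> foldr rcons (rev (map bar u)) (foldr rcons u w) = w"
  by (induction u arbitrary: w) (auto simp: rcons_bar_rcons reduced_foldr_rcons)

lemma group_free_group: "group (free_group A)"
proof (rule groupI)
  fix u v w
  show "u \<otimes>\<^bsub>free_group A\<^esub> v \<otimes>\<^bsub>free_group A\<^esub> w
      = u \<otimes>\<^bsub>free_group A\<^esub> (v \<otimes>\<^bsub>free_group A\<^esub> w)"
    (is "?l = ?r")
  proof -
    have app: "free_reduce (x @ y) = foldr rcons x (free_reduce y)" for x y :: "'a gword"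
      by (simp add: free_reduce_def)
    have "?l = foldr rcons (free_reduce (u @ v)) (free_reduce w)"
      by (simp add: free_group_def app[of "free_reduce (u @ v)" w])
    also have "\<dots> = foldr rcons (u @ v) (free_reduce w)"
      by (rule foldr_rcons_free_reduce[OF reduced_free_reduce])
    also have "\<dots> = ?r"
      by (simp add: free_group_def app free_reduce_reduced reduced_foldr_rcons
          reduced_free_reduce)
    finally show ?thesis .
  qed
next
  fix u assume u: "u \<in> carrier (free_group A)"
  have "rev (map bar u) \<in> lists (A <+> A)"
    using u by (auto simp: free_group_def)
  then have "free_reduce (rev (map bar u)) \<in> carrier (free_group A)"
    by (simp add: free_group_def reduced_free_reduce free_reduce_in_lists
        del: in_lists_conv_set)
  moreover have "free_reduce (free_reduce (rev (map bar u)) @ u) = []"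
    using foldr_rcons_inverse[of "[]" u]
    by (simp add: free_reduce_def[of "_ @ u"] foldr_rcons_free_reduce reduced_foldr_rcons)
  ultimately show "\<exists>v \<in> carrier (free_group A). v \<otimes>\<^bsub>free_group A\<^esub> u = \<one>\<^bsub>free_group A\<^esub>"
    by (intro bexI[of _ "free_reduce (rev (map bar u))"]) (simp add: free_group_def)
qed (simp_all add: free_group_def reduced_free_reduce free_reduce_reduced free_reduce_in_lists
      del: in_lists_conv_set)


section \<open>Finite-index extensions and commensurators\<close>

definition finitely_generated :: "('g, 'b) monoid_scheme \<Rightarrow> 'g set \<Rightarrow> bool" where
  "finitely_generated G H \<longleftrightarrow> (\<exists>S \<subseteq> carrier G. finite S \<and> H = generate G S)"

text \<open>\<open>finite_index G H K\<close> means \<open>[K : H] < \<infinity>\<close>, for subgroups \<open>H \<subseteq> K\<close> of \<open>G\<close>.\<close>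

definition finite_index :: "('g, 'b) monoid_scheme \<Rightarrow> 'g set \<Rightarrow> 'g set \<Rightarrow> bool" where
  "finite_index G H K \<longleftrightarrow> finite (rcosets\<^bsub>G\<lparr>carrier := K\<rparr>\<^esub> H)"

definition fi_extension :: "('g, 'b) monoid_scheme \<Rightarrow> 'g set \<Rightarrow> 'g set \<Rightarrow> bool" where
  "fi_extension G H K \<longleftrightarrow> subgroup K G \<and> H \<subseteq> K \<and> finite_index G H K"

definition max_fi_extension :: "('g, 'b) monoid_scheme \<Rightarrow> 'g set \<Rightarrow> 'g set" where
  "max_fi_extension G H = (GREATEST K. fi_extension G H K)"

definition conj_subgroup :: "('g, 'b) monoid_scheme \<Rightarrow> 'g set \<Rightarrow> 'g \<Rightarrow> 'g set" where
  "conj_subgroup G H g = (inv\<^bsub>G\<^esub> g <#\<^bsub>G\<^esub> H) #>\<^bsub>G\<^esub> g"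

definition commensurator :: "('g, 'b) monoid_scheme \<Rightarrow> 'g set \<Rightarrow> 'g set" where
  "commensurator G H =
     {g \<in> carrier G. finite_index G (H \<inter> conj_subgroup G H g) H \<and>
                     finite_index G (H \<inter> conj_subgroup G H g) (conj_subgroup G H g)}"


section \<open>Stallings graphs\<close>

text \<open>Edges are triples, so there are no two parallel edges with the same label; in particular,
  when vertices are identified, edges that get the same source, label and target become one
  edge.\<close>

record ('v, 'a) lgraph =
  verts :: "'v set"
  edges :: "('v \<times> 'a \<times> 'v) set"

record ('v, 'a) pointed_lgraph = "('v, 'a) lgraph" +
  base :: 'v

definition reduced_graph :: "('v, 'a, 'z) lgraph_scheme \<Rightarrow> bool" where
  "reduced_graph \<Gamma> \<longleftrightarrow>
     (\<forall>p a q q'. (p, a, q) \<in> edges \<Gamma> \<and> (p, a, q') \<in> edges \<Gamma> \<longrightarrow> q = q') \<and>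
     (\<forall>p p' a q. (p, a, q) \<in> edges \<Gamma> \<and> (p', a, q) \<in> edges \<Gamma> \<longrightarrow> p = p')"

definition degree :: "('v, 'a, 'z) lgraph_scheme \<Rightarrow> 'v \<Rightarrow> nat" where
  "degree \<Gamma> p = card {(q, a, r) \<in> edges \<Gamma>. q = p} + card {(q, a, r) \<in> edges \<Gamma>. r = p}"

fun edge_step :: "('v, 'a, 'z) lgraph_scheme \<Rightarrow> 'v \<Rightarrow> 'a + 'a \<Rightarrow> 'v \<Rightarrow> bool" where
  "edge_step \<Gamma> p (Inl a) q \<longleftrightarrow> (p, a, q) \<in> edges \<Gamma>"
| "edge_step \<Gamma> p (Inr a) q \<longleftrightarrow> (q, a, p) \<in> edges \<Gamma>"

fun walk :: "('v, 'a, 'z) lgraph_scheme \<Rightarrow> 'v \<Rightarrow> 'a gword \<Rightarrow> 'v \<Rightarrow> bool" where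
  "walk \<Gamma> p [] q \<longleftrightarrow> p \<in> verts \<Gamma> \<and> p = q"
| "walk \<Gamma> p (x # w) q \<longleftrightarrow> p \<in> verts \<Gamma> \<and> (\<exists>r. edge_step \<Gamma> p x r \<and> walk \<Gamma> r w q)"

text \<open>\<open>is_stallings A H \<Gamma>\<close> says that \<open>\<Gamma>\<close>, with its base vertex, is (a copy on the vertex type
  \<open>'v\<close> of) the representation of the subgroup \<open>H\<close> of the free group on \<open>A\<close>, which is unique up
  to isomorphism.\<close>

definition is_stallings :: "'a set \<Rightarrow> 'a gword set \<Rightarrow> ('v, 'a) pointed_lgraph \<Rightarrow> bool" where
  "is_stallings A H \<Gamma> \<longleftrightarrow>
     finite (verts \<Gamma>) \<and> base \<Gamma> \<in> verts \<Gamma> \<and> edges \<Gamma> \<subseteq> verts \<Gamma> \<times> A \<times> verts \<Gamma> \<and>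
     (\<forall>p \<in> verts \<Gamma>. \<forall>q \<in> verts \<Gamma>. \<exists>w. walk \<Gamma> p w q) \<and>
     reduced_graph \<Gamma> \<and>
     (\<forall>p \<in> verts \<Gamma>. p \<noteq> base \<Gamma> \<longrightarrow> degree \<Gamma> p \<ge> 2) \<and>
     (\<forall>w \<in> carrier (free_group A). w \<in> H \<longleftrightarrow> walk \<Gamma> (base \<Gamma>) w (base \<Gamma>))"

definition cyclically_reduced :: "('v, 'a) pointed_lgraph \<Rightarrow> bool" where
  "cyclically_reduced \<Gamma> \<longleftrightarrow> (\<forall>p \<in> verts \<Gamma>. degree \<Gamma> p \<ge> 2)"

inductive_set tail :: "('v, 'a) pointed_lgraph \<Rightarrow> 'v set" for \<Gamma> where
  base: "base \<Gamma> \<in> tail \<Gamma>"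
| step: "p \<in> tail \<Gamma> \<Longrightarrow> edge_step \<Gamma> p x q \<Longrightarrow> degree \<Gamma> q = 2 \<Longrightarrow> q \<in> tail \<Gamma>"

text \<open>For the trivial subgroup (one vertex, no edge) the core below is empty.\<close>

definition core :: "('v, 'a) pointed_lgraph \<Rightarrow> ('v, 'a) lgraph" where
  "core \<Gamma> =
     (if cyclically_reduced \<Gamma> then \<lparr>verts = verts \<Gamma>, edges = edges \<Gamma>\<rparr>
      else \<lparr>verts = verts \<Gamma> - tail \<Gamma>,
            edges = {(p, a, q) \<in> edges \<Gamma>. p \<notin> tail \<Gamma> \<and> q \<notin> tail \<Gamma>}\<rparr>)"

definition core_lang :: "('v, 'a) pointed_lgraph \<Rightarrow> 'v \<Rightarrow> 'a gword set" where
  "core_lang \<Gamma> p = {w. reduced w \<and> (\<exists>q. walk (core \<Gamma>) p w q)}"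

definition core_equiv :: "('v, 'a) pointed_lgraph \<Rightarrow> ('v \<times> 'v) set" where
  "core_equiv \<Gamma> =
     Id_on (verts \<Gamma>) \<union>
     {(p, q). p \<in> verts (core \<Gamma>) \<and> q \<in> verts (core \<Gamma>) \<and> core_lang \<Gamma> p = core_lang \<Gamma> q}"

definition quotient_graph ::
  "('v, 'a) pointed_lgraph \<Rightarrow> ('v \<times> 'v) set \<Rightarrow> ('v set, 'a) pointed_lgraph" where
  "quotient_graph \<Gamma> r =
     \<lparr>verts = verts \<Gamma> // r,
      edges = {(r `` {p}, a, r `` {q}) | p a q. (p, a, q) \<in> edges \<Gamma>},
      base = r `` {base \<Gamma>}\<rparr>"

lemma equiv_core_equiv: "equiv (verts \<Gamma>) (core_equiv \<Gamma>)"
proof (rule equivI)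
  show "core_equiv \<Gamma> \<subseteq> verts \<Gamma> \<times> verts \<Gamma>"
    by (auto simp: core_equiv_def core_def split: if_splits)
qed (auto simp: core_equiv_def refl_on_def sym_def trans_def)

end

(*
  Two core vertices with the same language admit the same core edges, again towards vertices with
  equal languages, so the core covers its image in the quotient. A reduced walk that enters the
  tail cannot return to the core; hence a reduced loop at a core vertex of the quotient lifts to
  the core, and the coset of H of an element of the quotient's loop group is determined by the end
  point of a lift. This bounds the index.

  Conversely, let g commensurate H. Up to conjugation, g starts at a core vertex v. Every word of
  L_v is a prefix of some u c^n u^-1 that loops at v, and g y^n g^-1 loops at v for suitable powers
  of every loop y. For long periodic words the reduced form keeps the prefix, so g ends at a
  core vertex with the language of v, and g is a loop of the quotient.
*)
theory Submission
  imports Defs "HOL-Library.Sublist"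
begin

section \<open>Words and cancellation\<close>

text \<open>The commensurator hypothesis controls single elements only: for each loop some power is
  carried to a loop, with an exponent that varies from loop to loop. A word of \<open>L_v\<close>
  therefore has to show up as a prefix in all high powers of one element. Continuing it to a
  conjugate \<open>u c^n u^-1\<close> with \<open>c @ c\<close> reduced achieves this: for large
  \<open>n\<close>, cancellation from the right stays within the periodic block.

  Maximality among finite-index extensions is a by-product when the core is nonempty: such an
  extension commensurates \<open>H\<close>, so it lies in the loop group of the quotient. An empty
  core means that \<open>H\<close> is trivial. Then every element of \<open>F\<close> commensurates
  \<open>H\<close>, while torsion-freeness leaves only the trivial finite-index extension; so
  equality with the commensurator is claimed for nontrivial \<open>H\<close> or empty
  \<open>A\<close>.

  Neither the extension nor the commensurator mentions a graph, so the existence of a Stallings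
  graph is proved too, by cutting the Schreier coset graph down to the vertices that elements of
  \<open>H\<close> pass through.\<close>

definition winv :: "'a gword \<Rightarrow> 'a gword" where
  "winv w = rev (map bar w)"

lemma winv_Nil [simp]: "winv [] = []"
  and winv_Cons: "winv (x # w) = winv w @ [bar x]"
  and winv_append: "winv (u @ v) = winv v @ winv u"
  and winv_winv [simp]: "winv (winv w) = w"
  and length_winv [simp]: "length (winv w) = length w"
  and winv_eq_Nil [simp]: "winv w = [] \<longleftrightarrow> w = []"
  by (simp_all add: winv_def rev_map comp_def)

lemma last_winv: "w \<noteq> [] \<Longrightarrow> last (winv w) = bar (hd w)"
  by (simp add: winv_def last_rev hd_map)

lemma hd_winv: "w \<noteq> [] \<Longrightarrow> hd (winv w) = bar (last w)"
  by (simp add: winv_def hd_rev last_map)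

lemma winv_in_lists [simp]: "winv w \<in> lists (A <+> A) \<longleftrightarrow> w \<in> lists (A <+> A)"
  by (auto simp: winv_def simp del: Plus_def)

lemma bar_neq [simp]: "bar x \<noteq> x" "x \<noteq> bar x"
  by (cases x; simp)+

lemma bar_swap: "x = bar y \<longleftrightarrow> y = bar x"
  by auto

lemma reduced_append_iff:
  "reduced (u @ v) \<longleftrightarrow> reduced u \<and> reduced v \<and> (u = [] \<or> v = [] \<or> hd v \<noteq> bar (last u))"
  by (auto simp: reduced_def successively_append_iff)

lemma reduced_Cons_iff: "reduced (x # w) \<longleftrightarrow> reduced w \<and> (w = [] \<or> hd w \<noteq> bar x)"
  using reduced_append_iff[of "[x]" w] by (auto simp: reduced_def)

lemma reduced_winv [simp]: "reduced (winv w) \<longleftrightarrow> reduced w"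
proof -
  have "reduced (winv w)" if "reduced w" for w :: "'a gword"
    using that
    by (induction w) (auto simp: winv_Cons reduced_append_iff reduced_Cons_iff last_winv)
  from this[of w] this[of "winv w"] show ?thesis by auto
qed

lemma free_reduce_Nil [simp]: "free_reduce [] = []"
  by (simp add: free_reduce_def)

lemma free_reduce_Cons: "free_reduce (x # w) = rcons x (free_reduce w)"
  by (simp add: free_reduce_def)

lemma free_reduce_append: "free_reduce (u @ v) = foldr rcons u (free_reduce v)"
  by (simp add: free_reduce_def)

lemma free_reduce_append_left [simp]: "free_reduce (free_reduce u @ v) = free_reduce (u @ v)"
  by (simp add: free_reduce_append foldr_rcons_free_reduce reduced_free_reduce)

lemma free_reduce_append_right [simp]: "free_reduce (u @ free_reduce v) = free_reduce (u @ v)"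
  by (simp add: free_reduce_append free_reduce_reduced reduced_free_reduce)

lemma free_reduce_winv_left [simp]: "free_reduce (winv u @ u) = []"
  using foldr_rcons_inverse[of "[]" u]
  by (simp add: free_reduce_def winv_def)

lemma free_reduce_cancel [simp]: "free_reduce (u @ bar x # x # v) = free_reduce (u @ v)"
  "free_reduce (u @ x # bar x # v) = free_reduce (u @ v)"
  using rcons_bar_rcons[OF reduced_free_reduce, of x v]
    rcons_bar_rcons[OF reduced_free_reduce, of "bar x" v]
  by (simp_all add: free_reduce_append free_reduce_Cons)

text \<open>Every letter of \<open>y\<close> cancels at most one letter at the right end of what
  precedes it, so at most \<open>length y\<close> letters of \<open>x\<close> are lost.\<close>

lemma prefix_free_reduce_append:
  assumes "reduced x" "prefix p x" "length p + length y \<le> length x"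
  shows "prefix p (free_reduce (x @ y))"
  using assms
proof (induction y arbitrary: x)
  case Nil
  then show ?case by (simp add: free_reduce_reduced)
next
  case (Cons a y)
  show ?case
  proof (cases "x \<noteq> [] \<and> last x = bar a")
    case True
    define x' where "x' = butlast x"
    have x: "x = x' @ [bar a]"
      using True x'_def by (metis append_butlast_last_id)
    have "prefix p x'"
      using Cons.prems x by (auto simp: prefix_snoc)
    then have "prefix p (free_reduce (x' @ y))"
      using Cons x by (simp add: reduced_append_iff)
    then show ?thesis using x by simp
  next
    case False
    then have "reduced (x @ [a])"
      using Cons.prems by (auto simp: reduced_append_iff reduced_Cons_iff bar_swap)
    then have "prefix p (free_reduce ((x @ [a]) @ y))"
      using Cons.prems by (intro Cons.IH) (auto simp: prefix_def)
    then show ?thesis by simp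
  qed
qed

text \<open>Serves to trace a prefix of a product back to a prefix of the unreduced concatenation,
  hence to the factors.\<close>

lemma prefix_free_reduceD:
  assumes "prefix u (free_reduce w)"
  shows "\<exists>z. prefix z w \<and> free_reduce z = u"
  using assms
proof (induction w arbitrary: u)
  case (Cons a w)
  have red: "reduced (free_reduce (a # w))" "reduced (free_reduce w)"
    by (rule reduced_free_reduce)+
  show ?case
  proof (cases "\<exists>w'. free_reduce w = bar a # w'")
    case True
    then obtain w' where w': "free_reduce w = bar a # w'" by blast
    \<comment> \<open>The new letter \<open>a\<close> cancels, so one letter more is asked of
      \<open>w\<close>: the leading \<open>bar a\<close> is what \<open>a\<close> removes
      again.\<close>
    then have "prefix (bar a # u) (free_reduce w)"
      using Cons.prems by (simp add: free_reduce_Cons)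
    then obtain z where "prefix z w" "free_reduce z = bar a # u"
      using Cons.IH by blast
    then show ?thesis
      by (intro exI[of _ "a # z"]) (simp add: free_reduce_Cons)
  next
    case False
    then have eq: "free_reduce (a # w) = a # free_reduce w"
      by (cases "free_reduce w") (auto simp: free_reduce_Cons)
    show ?thesis
    proof (cases u)
      case Nil
      then show ?thesis by (intro exI[of _ "[]"]) simp
    next
      case (Cons b u')
      then have b: "b = a" and u': "prefix u' (free_reduce w)"
        using Cons.prems eq by auto
      then obtain z where z: "prefix z w" "free_reduce z = u'"
        using Cons.IH by blast
      have "reduced (a # u')"
        using red(1) u' unfolding eq by (auto simp: prefix_def reduced_append_iff simp flip: append_Cons)
      then show ?thesis
        using z b Cons by (intro exI[of _ "a # z"]) (simp add: free_reduce_Cons rcons_reduced)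
    qed
  qed
qed simp

text \<open>Concatenation without reduction; it agrees with the group power when
  \<open>c @ c\<close> is reduced.\<close>

definition wpow :: "'a gword \<Rightarrow> nat \<Rightarrow> 'a gword" where
  "wpow c n = concat (replicate n c)"

lemma wpow_0 [simp]: "wpow c 0 = []"
  by (simp add: wpow_def)

lemma wpow_Suc: "wpow c (Suc n) = wpow c n @ c"
  by (simp add: wpow_def flip: replicate_append_same)

lemma length_wpow [simp]: "length (wpow c n) = n * length c"
  by (induction n) (auto simp: wpow_Suc)

lemma reduced_append_wpow:
  assumes "reduced (u @ c)" "reduced (c @ c)"
  shows "reduced (u @ wpow c n)"
proof (cases n)
  case 0
  then show ?thesis using assms by (simp add: reduced_append_iff)
next
  case (Suc m)
  have "reduced (u @ wpow c (Suc m))"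
  proof (induction m)
    case 0
    then show ?case using assms by (simp add: wpow_Suc)
  next
    case (Suc m)
    have "wpow c (Suc (Suc m)) = wpow c (Suc m) @ c"
      by (rule wpow_Suc)
    then show ?case
      using Suc assms(2) by (cases "c = []") (auto simp: wpow_Suc reduced_append_iff simp flip: append_assoc)
  qed
  then show ?thesis using Suc by simp
qed

text \<open>While the first and last letters are inverse to each other, they are stripped and
  collected in \<open>u\<close>. Something is always left, because \<open>x # [bar x]\<close> is not
  reduced.\<close>

lemma cyclic_reduction:
  assumes "reduced h" "h \<noteq> []"
  shows "\<exists>u c. h = u @ c @ winv u \<and> c \<noteq> [] \<and> reduced (c @ c)"
  using assms
proof (induction h rule: length_induct)
  case (1 h)
  show ?case
  proof (cases "reduced (h @ h)")
    case True
    then show ?thesis using 1 by (intro exI[of _ "[]"] exI[of _ h]) auto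
  next
    case False
    then have hl: "hd h = bar (last h)" using 1 by (auto simp: reduced_append_iff)
    define x where "x = hd h"
    have l: "last h = bar x" using hl x_def by simp
    have "tl h \<noteq> []"
    proof
      assume "tl h = []"
      then have "h = [x]" using 1 x_def by (metis list.collapse)
      then show False using l by simp
    qed
    then obtain h' where h: "h = x # h' @ [bar x]"
      using l x_def 1 by (metis append_butlast_last_id last_tl list.collapse)
    have "h' \<noteq> []" using 1 h by (auto simp: reduced_Cons_iff)
    moreover have "reduced h'" using 1 h by (auto simp: reduced_Cons_iff reduced_append_iff)
    ultimately obtain u c where "h' = u @ c @ winv u \<and> c \<noteq> [] \<and> reduced (c @ c)"
      using 1 h by (metis length_Cons length_append_singleton less_Suc_eq)
    then show ?thesis
      using h by (intro exI[of _ "x # u"] exI[of _ c]) (auto simp: winv_Cons)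
  qed
qed

section \<open>Products, inverses and powers in the free group\<close>

lemma carrier_free_group: "w \<in> carrier (free_group A) \<longleftrightarrow> w \<in> lists (A <+> A) \<and> reduced w"
  by (auto simp: free_group_def)

lemma mult_free_group: "u \<otimes>\<^bsub>free_group A\<^esub> v = free_reduce (u @ v)"
  by (simp add: free_group_def)

lemma one_free_group: "\<one>\<^bsub>free_group A\<^esub> = []"
  by (simp add: free_group_def)

lemma winv_carrier:
  "w \<in> carrier (free_group A) \<Longrightarrow> winv w \<in> carrier (free_group A)"
  by (simp add: carrier_free_group del: in_lists_conv_set)

lemma inv_free_group:
  assumes "w \<in> carrier (free_group A)"
  shows "inv\<^bsub>free_group A\<^esub> w = winv w"
  using group.inv_equality[OF group_free_group _ assms winv_carrier[OF assms]]
  by (simp add: mult_free_group one_free_group)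

lemma pow_free_group:
  assumes "reduced (c @ c)"
  shows "c [^]\<^bsub>free_group A\<^esub> (n::nat) = wpow c n"
proof -
  interpret group "free_group A" by (rule group_free_group)
  show ?thesis
  proof (induction n)
    case (Suc n)
    have "reduced (wpow c (Suc n))"
      using reduced_append_wpow[of "[]" c "Suc n"] assms by (simp add: reduced_append_iff)
    then show ?case
      using Suc by (simp add: mult_free_group wpow_Suc free_reduce_reduced)
  qed (simp add: one_free_group)
qed

lemma (in group) inv_mult_cancel:
  assumes "x \<in> carrier G" "y \<in> carrier G"
  shows "inv x \<otimes> (x \<otimes> y) = y" "x \<otimes> (inv x \<otimes> y) = y"
  using assms by (simp_all flip: m_assoc)

lemma (in group) conj_eq_oneD:
  assumes "x \<in> carrier G" "y \<in> carrier G" "x \<otimes> y \<otimes> inv x = \<one>"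
  shows "y = \<one>"
proof -
  have "y = inv x \<otimes> (x \<otimes> y \<otimes> inv x) \<otimes> x"
    using assms(1,2) by (simp add: m_assoc inv_mult_cancel)
  then show ?thesis using assms by simp
qed

lemma (in group) conj_pow:
  assumes "u \<in> carrier G" "c \<in> carrier G"
  shows "(u \<otimes> c \<otimes> inv u) [^] (n::nat) = u \<otimes> c [^] n \<otimes> inv u"
  using assms
proof (induction n)
  case (Suc n)
  have "(u \<otimes> c [^] n \<otimes> inv u) \<otimes> (u \<otimes> c \<otimes> inv u) = u \<otimes> c [^] n \<otimes> (inv u \<otimes> u) \<otimes> c \<otimes> inv u"
    using Suc.prems by (simp add: m_assoc inv_mult_cancel)
  then show ?case using Suc by (simp add: m_assoc)
qed simp

text \<open>After conjugation to a cyclically reduced \<open>c\<close>, the power is a plain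
  concatenation of length \<open>n * length c\<close>, which is positive.\<close>

lemma free_group_torsion_free:
  assumes "h \<in> carrier (free_group A)" "h [^]\<^bsub>free_group A\<^esub> (n::nat) = \<one>\<^bsub>free_group A\<^esub>" "n > 0"
  shows "h = \<one>\<^bsub>free_group A\<^esub>"
proof (rule ccontr)
  interpret group "free_group A" by (rule group_free_group)
  let ?F = "free_group A"
  assume "h \<noteq> \<one>\<^bsub>?F\<^esub>"
  then obtain u c where h: "h = u @ c @ winv u" and c: "c \<noteq> []" "reduced (c @ c)"
    using cyclic_reduction[of h] assms(1) by (auto simp: carrier_free_group one_free_group)
  have uc: "u \<in> carrier ?F" "c \<in> carrier ?F"
    using assms(1) h by (auto simp: carrier_free_group reduced_append_iff)
  have "h = u \<otimes>\<^bsub>?F\<^esub> c \<otimes>\<^bsub>?F\<^esub> inv\<^bsub>?F\<^esub> u"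
    using assms(1) h uc
    by (simp add: mult_free_group inv_free_group carrier_free_group free_reduce_reduced del: in_lists_conv_set)
  then have "u \<otimes>\<^bsub>?F\<^esub> c [^]\<^bsub>?F\<^esub> n \<otimes>\<^bsub>?F\<^esub> inv\<^bsub>?F\<^esub> u = \<one>\<^bsub>?F\<^esub>"
    using assms(2) conj_pow[OF uc, of n] by simp
  then have "c [^]\<^bsub>?F\<^esub> n = \<one>\<^bsub>?F\<^esub>"
    using conj_eq_oneD uc by blast
  then have "wpow c n = []"
    using c by (simp add: pow_free_group one_free_group)
  then have "n * length c = 0" by (metis length_wpow list.size(3))
  then show False using c assms(3) by simp
qed

section \<open>Finite index and commensurators in groups\<close>

text \<open>Bounds an index by counting values of any convenient \<open>f\<close> whose fibres lie
  in single cosets: later the end point of a lifted walk, or a coset of another subgroup.\<close>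

lemma (in group) finite_indexI:
  assumes "finite (f ` K)"
    and "\<And>x y. x \<in> K \<Longrightarrow> y \<in> K \<Longrightarrow> f x = f y \<Longrightarrow> x \<otimes> inv y \<in> M"
    and "subgroup M G" "subgroup K G"
  shows "finite_index G M K"
proof -
  have KG: "K \<subseteq> carrier G" using assms(4) by (rule subgroup.subset)
  have eq: "rcosets\<^bsub>G\<lparr>carrier := K\<rparr>\<^esub> M = (\<lambda>x. M #> x) ` K"
    by (auto simp: RCOSETS_def r_coset_def)
  have coset: "M #> x = M #> y" if "x \<in> K" "y \<in> K" "f x = f y" for x y
  proof -
    have xy: "x \<in> carrier G" "y \<in> carrier G" using that KG by auto
    have "x = (x \<otimes> inv y) \<otimes> y" using xy by (simp add: m_assoc)
    then have "x \<in> M #> y" using assms(2)[OF that] unfolding r_coset_def by blast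
    then show ?thesis
      using repr_independence[OF _ xy(2) assms(3)] by blast
  qed
  have "(\<lambda>x. M #> x) ` K = (\<lambda>z. M #> (SOME x. x \<in> K \<and> f x = z)) ` (f ` K)"
  proof -
    have "M #> x = M #> (SOME y. y \<in> K \<and> f y = f x)" if "x \<in> K" for x
      using someI[of "\<lambda>y. y \<in> K \<and> f y = f x" x] that by (intro coset) auto
    then show ?thesis by (simp add: image_image cong: image_cong)
  qed
  then show ?thesis
    using assms(1) by (simp add: finite_index_def eq)
qed

lemma (in group) finite_indexE:
  assumes "finite_index G M K" "subgroup M G" "subgroup K G"
  shows "finite ((\<lambda>x. M #> x) ` K)"
    and "\<And>x y. x \<in> K \<Longrightarrow> y \<in> K \<Longrightarrow> M #> x = M #> y \<Longrightarrow> x \<otimes> inv y \<in> M"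
proof -
  have eq: "rcosets\<^bsub>G\<lparr>carrier := K\<rparr>\<^esub> M = (\<lambda>x. M #> x) ` K"
    by (auto simp: RCOSETS_def r_coset_def)
  show "finite ((\<lambda>x. M #> x) ` K)"
    using assms(1) by (simp add: finite_index_def eq)
  fix x y assume x: "x \<in> K" and y: "y \<in> K" and e: "M #> x = M #> y"
  have xy: "x \<in> carrier G" "y \<in> carrier G" using x y assms(3) by (auto dest: subgroup.mem_carrier)
  have "x \<in> M #> y" using e rcos_self[OF xy(1) assms(2)] by simp
  then obtain m where "m \<in> M" "x = m \<otimes> y" by (auto simp: r_coset_def)
  then show "x \<otimes> inv y \<in> M"
    using xy assms(2) by (simp add: m_assoc subgroup.mem_carrier)
qed

text \<open>Pigeonhole: two powers of \<open>x\<close> lie in the same coset, and the difference of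
  their exponents works.\<close>

lemma (in group) finite_index_pow:
  assumes "finite_index G M K" "subgroup M G" "subgroup K G" "x \<in> K"
  shows "\<exists>n>0. x [^] (n::nat) \<in> M"
proof -
  have x: "x \<in> carrier G" using assms by (auto dest: subgroup.mem_carrier)
  have xK: "x [^] (i::nat) \<in> K" for i
    using assms(3,4) by (induction i) (auto simp: subgroup.one_closed subgroup.m_closed)
  have "\<not> inj (\<lambda>i::nat. M #> x [^] i)"
  proof
    assume "inj (\<lambda>i::nat. M #> x [^] i)"
    moreover have "range (\<lambda>i::nat. M #> x [^] i) \<subseteq> (\<lambda>x. M #> x) ` K" using xK by auto
    ultimately show False
      using finite_indexE(1)[OF assms(1-3)] finite_subset finite_imageD infinite_UNIV_nat by blast
  qed
  then obtain i j :: nat where "i < j" and e: "M #> x [^] j = M #> x [^] i"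
    by (metis injI linorder_neqE_nat)
  then have "x [^] j \<otimes> inv (x [^] i) \<in> M"
    using finite_indexE(2)[OF assms(1-3)] xK by blast
  moreover have "x [^] j = x [^] (j - i) \<otimes> x [^] i"
    using x \<open>i < j\<close> by (simp add: nat_pow_mult)
  ultimately have "x [^] (j - i) \<in> M" using x by (simp add: m_assoc)
  then show ?thesis using \<open>i < j\<close> by (intro exI[of _ "j - i"]) simp
qed

lemma (in group) conj_subgroup_iff:
  assumes "H \<subseteq> carrier G" "g \<in> carrier G"
  shows "x \<in> conj_subgroup G H g \<longleftrightarrow> x \<in> carrier G \<and> g \<otimes> x \<otimes> inv g \<in> H"
proof
  assume "x \<in> conj_subgroup G H g"
  then obtain h where h: "h \<in> H" "x = inv g \<otimes> h \<otimes> g"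
    by (auto simp: conj_subgroup_def l_coset_def r_coset_def)
  moreover have "h \<in> carrier G" using h assms by auto
  moreover have "g \<otimes> (inv g \<otimes> h \<otimes> g) \<otimes> inv g = (g \<otimes> inv g) \<otimes> h \<otimes> (g \<otimes> inv g)"
    using assms h by (simp add: m_assoc subset_iff inv_mult_cancel)
  ultimately show "x \<in> carrier G \<and> g \<otimes> x \<otimes> inv g \<in> H"
    using assms by simp
next
  assume x: "x \<in> carrier G \<and> g \<otimes> x \<otimes> inv g \<in> H"
  then have "x = inv g \<otimes> (g \<otimes> x \<otimes> inv g) \<otimes> g"
    using assms by (simp add: m_assoc inv_mult_cancel)
  then show "x \<in> conj_subgroup G H g"
    using x unfolding conj_subgroup_def l_coset_def r_coset_def by blast
qed

lemma (in group) subgroup_conj_subgroup: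
  assumes "subgroup H G" "g \<in> carrier G"
  shows "subgroup (conj_subgroup G H g) G"
proof -
  have HG: "H \<subseteq> carrier G" using assms(1) by (rule subgroup.subset)
  note iff = conj_subgroup_iff[OF HG assms(2)]
  show ?thesis
  proof (rule subgroupI)
    show "conj_subgroup G H g \<subseteq> carrier G" using iff by auto
    show "conj_subgroup G H g \<noteq> {}"
      using iff[of \<one>] assms by (auto simp: subgroup.one_closed)
  next
    fix a assume "a \<in> conj_subgroup G H g"
    then have a: "a \<in> carrier G" "g \<otimes> a \<otimes> inv g \<in> H" using iff by auto
    have "g \<otimes> inv a \<otimes> inv g = inv (g \<otimes> a \<otimes> inv g)"
      using a assms by (simp add: inv_mult_group m_assoc)
    then show "inv a \<in> conj_subgroup G H g"
      using a assms iff by (auto simp: subgroup.m_inv_closed)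
  next
    fix a b assume "a \<in> conj_subgroup G H g" "b \<in> conj_subgroup G H g"
    then have a: "a \<in> carrier G" "g \<otimes> a \<otimes> inv g \<in> H"
      and b: "b \<in> carrier G" "g \<otimes> b \<otimes> inv g \<in> H" using iff by auto
    have "(g \<otimes> a \<otimes> inv g) \<otimes> (g \<otimes> b \<otimes> inv g) = g \<otimes> a \<otimes> (inv g \<otimes> g) \<otimes> b \<otimes> inv g"
      using a b assms by (simp add: m_assoc inv_mult_cancel)
    then have "g \<otimes> (a \<otimes> b) \<otimes> inv g = (g \<otimes> a \<otimes> inv g) \<otimes> (g \<otimes> b \<otimes> inv g)"
      using a b assms by (simp add: m_assoc)
    then show "a \<otimes> b \<in> conj_subgroup G H g"
      using a b assms(1) iff by (auto simp: subgroup.m_closed)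
  qed
qed

text \<open>For \<open>g\<close> in \<open>K\<close> the conjugate also lies in \<open>K\<close>, so
  both indices are bounded by the number of cosets of \<open>H\<close> in \<open>K\<close>. On
  \<open>H\<close> the cosets of \<open>g \<otimes> h\<close> are counted, since their agreement
  says exactly that a quotient lies in the conjugate; on the conjugate the cosets of
  \<open>h\<close> itself.\<close>

lemma (in group) fi_extension_subset_commensurator:
  assumes "fi_extension G H K" "subgroup H G"
  shows "K \<subseteq> commensurator G H"
proof
  fix g assume g: "g \<in> K"
  have K: "subgroup K G" "H \<subseteq> K" "finite_index G H K"
    using assms by (auto simp: fi_extension_def)
  note KG = subgroup.mem_carrier[OF K(1)]
  have gG: "g \<in> carrier G" using g KG by auto
  have HG: "H \<subseteq> carrier G" using K KG by auto
  let ?Hg = "conj_subgroup G H g"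
  note iff = conj_subgroup_iff[OF HG gG]
  have sub: "subgroup ?Hg G" "subgroup (H \<inter> ?Hg) G"
    using subgroup_conj_subgroup[OF assms(2) gG] assms(2) subgroups_Inter_pair by auto
  have HgK: "?Hg \<subseteq> K"
  proof
    fix x assume "x \<in> ?Hg"
    then have x: "x \<in> carrier G" "g \<otimes> x \<otimes> inv g \<in> K" using iff K by auto
    then have "inv g \<otimes> (g \<otimes> x \<otimes> inv g) \<otimes> g \<in> K"
      using g K(1) by (simp add: subgroup.m_closed subgroup.m_inv_closed)
    moreover have "inv g \<otimes> (g \<otimes> x \<otimes> inv g) \<otimes> g = x"
      using x gG by (simp add: m_assoc inv_mult_cancel)
    ultimately show "x \<in> K" by simp
  qed
  note fin = finite_indexE[OF K(3) assms(2) K(1)]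
  have "finite_index G (H \<inter> ?Hg) H"
  proof (rule finite_indexI[where f = "\<lambda>h. H #> (g \<otimes> h)"])
    show "finite ((\<lambda>h. H #> (g \<otimes> h)) ` H)"
      by (rule finite_subset[OF _ fin(1)]) (use g K in \<open>auto intro: subgroup.m_closed\<close>)
    fix x y assume x: "x \<in> H" and y: "y \<in> H" and "H #> (g \<otimes> x) = H #> (g \<otimes> y)"
    then have "(g \<otimes> x) \<otimes> inv (g \<otimes> y) \<in> H"
      using g K by (intro fin(2)) (auto intro: subgroup.m_closed)
    moreover have "(g \<otimes> x) \<otimes> inv (g \<otimes> y) = g \<otimes> (x \<otimes> inv y) \<otimes> inv g"
      using x y HG gG by (simp add: inv_mult_group m_assoc subset_iff)
    ultimately show "x \<otimes> inv y \<in> H \<inter> ?Hg"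
      using x y HG iff assms(2) by (auto simp: subgroup.m_closed subgroup.m_inv_closed)
  qed (use sub assms in auto)
  moreover have "finite_index G (H \<inter> ?Hg) ?Hg"
  proof (rule finite_indexI[where f = "\<lambda>h. H #> h"])
    show "finite ((\<lambda>h. H #> h) ` ?Hg)"
      by (rule finite_subset[OF _ fin(1)]) (use HgK in auto)
    fix x y assume x: "x \<in> ?Hg" and y: "y \<in> ?Hg" and "H #> x = H #> y"
    then have "x \<otimes> inv y \<in> H"
      using HgK by (intro fin(2)) auto
    then show "x \<otimes> inv y \<in> H \<inter> ?Hg"
      using x y sub by (auto simp: subgroup.m_closed subgroup.m_inv_closed)
  qed (use sub assms in auto)
  ultimately show "g \<in> commensurator G H"
    using gG by (simp add: commensurator_def)
qed

text \<open>The two finite-index conditions enter the graph argument only through these powers. The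
  second claim is the power argument for \<open>inv g \<otimes> h \<otimes> g\<close>, an element of
  the conjugate.\<close>

lemma (in group) commensurator_pow:
  assumes "subgroup H G" "g \<in> commensurator G H" "h \<in> H"
  shows "\<exists>n>0. g \<otimes> h [^] (n::nat) \<otimes> inv g \<in> H"
    and "\<exists>n>0. inv g \<otimes> h [^] (n::nat) \<otimes> g \<in> H"
proof -
  have gG: "g \<in> carrier G" and fi: "finite_index G (H \<inter> conj_subgroup G H g) H"
     "finite_index G (H \<inter> conj_subgroup G H g) (conj_subgroup G H g)"
    using assms by (auto simp: commensurator_def)
  have HG: "H \<subseteq> carrier G" using assms(1) by (rule subgroup.subset)
  let ?Hg = "conj_subgroup G H g"
  note iff = conj_subgroup_iff[OF HG gG]
  have sub: "subgroup ?Hg G" "subgroup (H \<inter> ?Hg) G"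
    using subgroup_conj_subgroup[OF assms(1) gG] assms(1) subgroups_Inter_pair by auto
  have h: "h \<in> carrier G" using assms HG by auto
  show "\<exists>n>0. g \<otimes> h [^] (n::nat) \<otimes> inv g \<in> H"
    using finite_index_pow[OF fi(1) sub(2) assms(1,3)] iff by auto
  have "g \<otimes> (inv g \<otimes> h \<otimes> g) \<otimes> inv g = h"
    using h gG by (simp add: m_assoc inv_mult_cancel)
  then have "inv g \<otimes> h \<otimes> g \<in> ?Hg" using iff h gG assms(3) by auto
  from finite_index_pow[OF fi(2) sub(2,1) this]
  obtain n :: nat where n: "n > 0" "(inv g \<otimes> h \<otimes> g) [^] n \<in> H" by auto
  then show "\<exists>n>0. inv g \<otimes> h [^] (n::nat) \<otimes> g \<in> H"
    using conj_pow[of "inv g" h n] h gG by auto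
qed

section \<open>Folded graphs, tails and cores\<close>

lemma edge_step_bar [simp]: "edge_step \<Gamma> p (bar x) q \<longleftrightarrow> edge_step \<Gamma> q x p"
  by (cases x) auto

lemma walk_append: "walk \<Gamma> p (u @ v) q \<longleftrightarrow> (\<exists>r. walk \<Gamma> p u r \<and> walk \<Gamma> r v q)"
proof (induction u arbitrary: p)
  case Nil
  then show ?case by (cases v) auto
qed auto

lemma walk_source: "walk \<Gamma> p w q \<Longrightarrow> p \<in> verts \<Gamma>"
  by (cases w) auto

lemma walk_target: "walk \<Gamma> p w q \<Longrightarrow> q \<in> verts \<Gamma>"
  by (induction w arbitrary: p) auto

definition letters :: "('v, 'a, 'z) lgraph_scheme \<Rightarrow> 'v \<Rightarrow> ('a + 'a) set" where
  "letters \<Gamma> p = {x. \<exists>q. edge_step \<Gamma> p x q}"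

text \<open>Common ground for the Stallings graph, its core, its quotient and the Schreier graph;
  the general record scheme covers graphs with and without a base.\<close>

locale folded_graph =
  fixes \<Gamma> :: "('v, 'a, 'z) lgraph_scheme"
  assumes edges_verts: "edges \<Gamma> \<subseteq> verts \<Gamma> \<times> UNIV \<times> verts \<Gamma>"
    and finite_edges: "finite (edges \<Gamma>)"
    and reduced_graph: "reduced_graph \<Gamma>"
begin

lemma edge_step_verts: "edge_step \<Gamma> p x q \<Longrightarrow> p \<in> verts \<Gamma> \<and> q \<in> verts \<Gamma>"
  using edges_verts by (cases x) auto

lemma walk_single [simp]: "walk \<Gamma> p [x] q \<longleftrightarrow> edge_step \<Gamma> p x q"
  using edge_step_verts by auto

lemma edge_step_unique: "edge_step \<Gamma> p x q \<Longrightarrow> edge_step \<Gamma> p x q' \<Longrightarrow> q = q'"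
  using reduced_graph unfolding reduced_graph_def by (cases x) (simp_all, blast+)

lemma edge_step_unique_source: "edge_step \<Gamma> p x q \<Longrightarrow> edge_step \<Gamma> p' x q \<Longrightarrow> p = p'"
  using edge_step_unique[of q "bar x" p p'] by simp

lemma walk_unique: "walk \<Gamma> p w q \<Longrightarrow> walk \<Gamma> p w q' \<Longrightarrow> q = q'"
  by (induction w arbitrary: p) (auto dest: edge_step_unique)

lemma walk_winv: "walk \<Gamma> p w q \<Longrightarrow> walk \<Gamma> q (winv w) p"
proof (induction w arbitrary: p)
  case (Cons x w)
  then show ?case using edge_step_verts by (force simp: winv_Cons walk_append)
qed auto

text \<open>If \<open>x\<close> cancels, foldedness forces the walk to be back at \<open>p\<close>
  after the cancelled pair.\<close>

lemma walk_rcons: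
  assumes "edge_step \<Gamma> p x r" "walk \<Gamma> r w q"
  shows "walk \<Gamma> p (rcons x w) q"
proof (cases w)
  case (Cons y v)
  show ?thesis
  proof (cases "y = bar x")
    case True
    then have "walk \<Gamma> p v q" using assms Cons edge_step_unique_source by auto
    then show ?thesis using True Cons by simp
  qed (use assms Cons edge_step_verts in auto)
qed (use assms edge_step_verts in auto)

lemma walk_free_reduce: "walk \<Gamma> p w q \<Longrightarrow> walk \<Gamma> p (free_reduce w) q"
  by (induction w arbitrary: p) (auto simp: free_reduce_Cons intro: walk_rcons)

lemma finite_letters: "finite (letters \<Gamma> p)"
proof (rule finite_subset)
  show "letters \<Gamma> p \<subseteq> (\<lambda>(q, a, r). Inl a) ` edges \<Gamma> \<union> (\<lambda>(q, a, r). Inr a) ` edges \<Gamma>"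
  proof
    fix x assume "x \<in> letters \<Gamma> p"
    then obtain q where "edge_step \<Gamma> p x q" by (auto simp: letters_def)
    then show "x \<in> (\<lambda>(q, a, r). Inl a) ` edges \<Gamma> \<union> (\<lambda>(q, a, r). Inr a) ` edges \<Gamma>"
      by (cases x) force+
  qed
qed (use finite_edges in auto)

text \<open>In a folded graph distinct edge ends at \<open>p\<close> carry distinct letters,
  \<open>Inl\<close> for outgoing and \<open>Inr\<close> for incoming ones; a loop counts once on
  each side.\<close>

lemma degree_eq_card_letters: "degree \<Gamma> p = card (letters \<Gamma> p)"
proof -
  define Out where "Out = {(q, a, r) \<in> edges \<Gamma>. q = p}"
  define In where "In = {(q, a, r) \<in> edges \<Gamma>. r = p}"
  have fin: "finite Out" "finite In"
    using finite_edges by (auto simp: Out_def In_def intro: finite_subset[OF _ finite_edges])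
  have inj: "inj_on (\<lambda>(q, a, r). Inl a :: 'a + 'a) Out" "inj_on (\<lambda>(q, a, r). Inr a :: 'a + 'a) In"
    using edge_step_unique[of _ "Inl _"] edge_step_unique[of _ "Inr _"]
    by (auto simp: inj_on_def Out_def In_def)
  have "letters \<Gamma> p = (\<lambda>(q, a, r). Inl a) ` Out \<union> (\<lambda>(q, a, r). Inr a) ` In"
  proof (rule Set.set_eqI)
    fix x
    show "x \<in> letters \<Gamma> p \<longleftrightarrow> x \<in> (\<lambda>(q, a, r). Inl a) ` Out \<union> (\<lambda>(q, a, r). Inr a) ` In"
      by (cases x) (force simp: letters_def Out_def In_def)+
  qed
  moreover have "(\<lambda>(q, a, r). Inl a :: 'a + 'a) ` Out \<inter> (\<lambda>(q, a, r). Inr a) ` In = {}"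
    by auto
  ultimately have "card (letters \<Gamma> p) = card Out + card In"
    using fin inj by (simp add: card_Un_disjoint card_image)
  then show ?thesis by (simp add: degree_def Out_def In_def)
qed

end

text \<open>The requirements of \<open>is_stallings\<close> that do not mention the subgroup, so
  that they can be verified for the quotient before its loop group is introduced.\<close>

locale pointed_graph =
  folded_graph \<Gamma> for \<Gamma> :: "('v, 'a) pointed_lgraph" +
  assumes finite_verts: "finite (verts \<Gamma>)"
    and base_verts: "base \<Gamma> \<in> verts \<Gamma>"
    and connected: "p \<in> verts \<Gamma> \<Longrightarrow> q \<in> verts \<Gamma> \<Longrightarrow> \<exists>w. walk \<Gamma> p w q"
    and degree_ge: "p \<in> verts \<Gamma> \<Longrightarrow> p \<noteq> base \<Gamma> \<Longrightarrow> degree \<Gamma> p \<ge> 2"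
begin

section \<open>Shape of the tail and walks in the core\<close>

lemma tail_verts: "p \<in> tail \<Gamma> \<Longrightarrow> p \<in> verts \<Gamma>"
  by (induction rule: tail.induct) (auto simp: base_verts dest: edge_step_verts)

lemma degree_tail: "p \<in> tail \<Gamma> \<Longrightarrow> p \<noteq> base \<Gamma> \<Longrightarrow> degree \<Gamma> p = 2"
  by (auto elim: tail.cases)

lemma degree_base: "\<not> cyclically_reduced \<Gamma> \<Longrightarrow> degree \<Gamma> (base \<Gamma>) \<le> 1"
  using degree_ge unfolding cyclically_reduced_def by force

lemma edge_step_core_iff:
  "edge_step (core \<Gamma>) p x q \<longleftrightarrow>
     edge_step \<Gamma> p x q \<and> p \<in> verts (core \<Gamma>) \<and> q \<in> verts (core \<Gamma>)"
  using edge_step_verts[of p x q] by (cases x) (auto simp: core_def)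

lemma verts_core: "verts (core \<Gamma>) = (if cyclically_reduced \<Gamma> then verts \<Gamma> else verts \<Gamma> - tail \<Gamma>)"
  by (simp add: core_def)

lemma core_verts: "p \<in> verts (core \<Gamma>) \<Longrightarrow> p \<in> verts \<Gamma>"
  by (auto simp: core_def split: if_splits)

lemma not_coreD: "p \<in> verts \<Gamma> \<Longrightarrow> p \<notin> verts (core \<Gamma>) \<Longrightarrow> \<not> cyclically_reduced \<Gamma> \<and> p \<in> tail \<Gamma>"
  by (auto simp: verts_core split: if_splits)

sublocale core: folded_graph "core \<Gamma>"
proof
  show "edges (core \<Gamma>) \<subseteq> verts (core \<Gamma>) \<times> UNIV \<times> verts (core \<Gamma>)"
    using edges_verts by (auto simp: core_def)
  show "finite (edges (core \<Gamma>))"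
    by (rule finite_subset[OF _ finite_edges]) (auto simp: core_def split: if_splits)
  show "reduced_graph (core \<Gamma>)"
    using reduced_graph unfolding reduced_graph_def core_def by (simp; blast)
qed

lemma walk_coreD: "walk (core \<Gamma>) p w q \<Longrightarrow> walk \<Gamma> p w q"
  by (induction w arbitrary: p) (auto simp: edge_step_core_iff core_verts)

lemma walk_coreI:
  assumes "walk \<Gamma> p w q" "\<And>u r. prefix u w \<Longrightarrow> walk \<Gamma> p u r \<Longrightarrow> r \<in> verts (core \<Gamma>)"
  shows "walk (core \<Gamma>) p w q"
  using assms
proof (induction w arbitrary: p)
  case Nil
  then show ?case by auto
next
  case (Cons x w)
  then obtain r where r: "edge_step \<Gamma> p x r" "walk \<Gamma> r w q" by auto
  have "walk (core \<Gamma>) r w q"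
  proof (rule Cons.IH[OF r(2)])
    fix u t assume "prefix u w" "walk \<Gamma> r u t"
    then show "t \<in> verts (core \<Gamma>)"
      using Cons.prems r(1) by (intro Cons.prems(2)[of "x # u" t]) auto
  qed
  moreover have "p \<in> verts (core \<Gamma>)"
    using Cons.prems(2)[of "[]" p] Cons.prems(1) by simp
  ultimately show ?case
    using r(1) walk_source[of "core \<Gamma>" r w q] by (auto simp: edge_step_core_iff)
qed

text \<open>The tail is a line; \<open>x\<close> is the letter that leads from \<open>p\<close> towards the core.\<close>

lemma tail_direction:
  assumes "\<not> cyclically_reduced \<Gamma>" "p \<in> tail \<Gamma>"
  shows "\<exists>x. \<forall>w q. reduced w \<and> walk \<Gamma> p w q \<and> (w = [] \<or> hd w \<noteq> x) \<longrightarrow> q \<in> tail \<Gamma>"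
  using assms(2)
proof (induction rule: tail.induct)
  case base
  have "card (letters \<Gamma> (base \<Gamma>)) \<le> 1"
    using degree_base[OF assms(1)] by (simp add: degree_eq_card_letters)
  then obtain x where "letters \<Gamma> (base \<Gamma>) \<subseteq> {x}"
    using finite_letters by (metis card_le_Suc0_iff_eq One_nat_def singletonI subsetI all_not_in_conv)
  then have "w = []" if "walk \<Gamma> (base \<Gamma>) w q" "w = [] \<or> hd w \<noteq> x" for w q
    using that by (cases w) (auto simp: letters_def)
  then show ?case by (metis tail.base walk.simps(1))
next
  case (step p y q)
  then obtain x where
    x: "\<And>w q. reduced w \<Longrightarrow> walk \<Gamma> p w q \<Longrightarrow> w = [] \<or> hd w \<noteq> x \<Longrightarrow> q \<in> tail \<Gamma>"
    by blast
  have q: "q \<in> tail \<Gamma>" using step by (auto intro: tail.step)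
  \<comment> \<open>If the step to \<open>q\<close> goes away from the core, the new direction is
    \<open>bar y\<close>, since prefixing \<open>y\<close> gives a walk from \<open>p\<close> in the
    wrong direction. If it goes towards the core, \<open>q\<close> has exactly one letter besides
    \<open>bar y\<close>, and that one is the direction.\<close>
  show ?case
  proof (cases "y = x")
    case False
    have "r \<in> tail \<Gamma>" if "reduced w" "walk \<Gamma> q w r" "w = [] \<or> hd w \<noteq> bar y" for w r
      using that step(2) False edge_step_verts[OF step(2)]
      by (intro x[of "y # w"]) (auto simp: reduced_Cons_iff)
    then show ?thesis by blast
  next
    case True
    have y: "bar y \<in> letters \<Gamma> q" using step(2) by (auto simp: letters_def)
    have "card (letters \<Gamma> q - {bar y}) = 1"
      using y step(3) by (simp add: finite_letters degree_eq_card_letters)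
    then obtain z where z: "letters \<Gamma> q - {bar y} = {z}"
      by (auto simp: card_1_singleton_iff)
    have "r \<in> tail \<Gamma>" if w: "reduced w" "walk \<Gamma> q w r" "w = [] \<or> hd w \<noteq> z" for w r
    proof (cases w)
      case Nil
      then show ?thesis using w q by auto
    next
      case (Cons a v)
      then have "a \<in> letters \<Gamma> q" "a \<noteq> z" using w by (auto simp: letters_def)
      then have a: "a = bar y" using z by blast
      then have "walk \<Gamma> p v r" using w Cons step(2) edge_step_unique_source by auto
      then show ?thesis
        using w Cons a True by (intro x[of v]) (auto simp: reduced_Cons_iff)
    qed
    then show ?thesis by blast
  qed
qed

text \<open>At a tail vertex both the way on and the way back would have to begin with the one
  letter that points to the core, so the word would not be reduced there.\<close>

lemma walk_core_iff:
  assumes "reduced w" "p \<in> verts (core \<Gamma>)" "q \<in> verts (core \<Gamma>)"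
  shows "walk (core \<Gamma>) p w q \<longleftrightarrow> walk \<Gamma> p w q"
proof
  assume w: "walk \<Gamma> p w q"
  show "walk (core \<Gamma>) p w q"
  proof (rule walk_coreI[OF w], rule ccontr)
    fix u r assume u: "prefix u w" "walk \<Gamma> p u r" and r: "r \<notin> verts (core \<Gamma>)"
    have t: "\<not> cyclically_reduced \<Gamma>" "r \<in> tail \<Gamma>"
      using not_coreD[OF walk_target[OF u(2)] r] by auto
    then obtain x where
      x: "\<And>w q. reduced w \<Longrightarrow> walk \<Gamma> r w q \<Longrightarrow> w = [] \<or> hd w \<noteq> x \<Longrightarrow> q \<in> tail \<Gamma>"
      using tail_direction by meson
    obtain v where v: "w = u @ v" using u by (auto simp: prefix_def)
    then have vr: "walk \<Gamma> r v q" using w u walk_unique by (auto simp: walk_append)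
    have ur: "walk \<Gamma> r (winv u) p" using u walk_winv by blast
    have "p \<notin> tail \<Gamma>" "q \<notin> tail \<Gamma>" using assms t by (auto simp: verts_core)
    then have "v \<noteq> [] \<and> hd v = x \<and> winv u \<noteq> [] \<and> hd (winv u) = x"
      using x[OF _ vr] x[OF _ ur] assms(1) v by (auto simp: reduced_append_iff)
    then show False
      using assms(1) v by (auto simp: reduced_append_iff hd_winv)
  qed
qed (rule walk_coreD)

text \<open>An access word for each tail vertex turns questions about the shape of the tail into
  questions about prefixes.\<close>

lemma tail_word:
  assumes "p \<in> tail \<Gamma>"
  shows "\<exists>w. reduced w \<and> walk \<Gamma> (base \<Gamma>) w p \<and>
           (\<forall>u r. prefix u w \<longrightarrow> walk \<Gamma> (base \<Gamma>) u r \<longrightarrow> r \<in> tail \<Gamma>)"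
  using assms
proof (induction rule: tail.induct)
  case base
  then show ?case by (intro exI[of _ "[]"]) (auto simp: base_verts tail.base)
next
  case (step p y q)
  then obtain w where w: "reduced w" "walk \<Gamma> (base \<Gamma>) w p"
    "\<And>u r. prefix u w \<Longrightarrow> walk \<Gamma> (base \<Gamma>) u r \<Longrightarrow> r \<in> tail \<Gamma>"
    by blast
  have q: "q \<in> tail \<Gamma>" using step by (auto intro: tail.step)
  show ?case
  proof (cases "w \<noteq> [] \<and> last w = bar y")
    case True
    then obtain v where v: "w = v @ [bar y]" by (metis append_butlast_last_id)
    then have "walk \<Gamma> (base \<Gamma>) v q"
      using w by (auto simp: walk_append dest: edge_step_unique[OF step(2)])
    then show ?thesis using v w by (intro exI[of _ v]) (auto simp: reduced_append_iff)
  next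
    case False
    have wq: "walk \<Gamma> (base \<Gamma>) (w @ [y]) q"
      using w step(2) edge_step_verts by (auto simp: walk_append)
    have "reduced (w @ [y])" using False w by (auto simp: reduced_append_iff reduced_Cons_iff bar_swap)
    moreover have "r \<in> tail \<Gamma>" if "prefix u (w @ [y])" "walk \<Gamma> (base \<Gamma>) u r" for u r
      using that w(3) q walk_unique[OF wq] by (auto simp: prefix_snoc)
    ultimately show ?thesis using wq by blast
  qed
qed

text \<open>The tail does not branch: where two words part, the letters \<open>b\<close> and
  \<open>c\<close> and the letter leading back would be three at a vertex of degree 2. The base
  cannot be that vertex, as its degree is at most 1.\<close>

lemma tail_walks_comparable:
  assumes "\<not> cyclically_reduced \<Gamma>" "reduced u" "reduced v"
    and "walk \<Gamma> (base \<Gamma>) u p" "walk \<Gamma> (base \<Gamma>) v q"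
    and tail: "\<And>z r. strict_prefix z u \<Longrightarrow> walk \<Gamma> (base \<Gamma>) z r \<Longrightarrow> r \<in> tail \<Gamma>"
  shows "prefix u v \<or> prefix v u"
proof (rule ccontr)
  assume "\<not> (prefix u v \<or> prefix v u)"
  then have "u \<parallel> v" by auto
  then obtain z b bs c cs where bc: "b \<noteq> c" and u: "u = z @ b # bs" and v: "v = z @ c # cs"
    using parallel_decomp by blast
  obtain s where s: "walk \<Gamma> (base \<Gamma>) z s" "b \<in> letters \<Gamma> s"
    using assms(4) u by (auto simp: walk_append letters_def)
  then have c: "c \<in> letters \<Gamma> s"
    using assms(5) v walk_unique by (force simp: walk_append letters_def)
  have st: "s \<in> tail \<Gamma>" using tail[OF _ s(1)] u by (auto simp: strict_prefix_def)
  have le: "card X \<le> degree \<Gamma> s" if "X \<subseteq> letters \<Gamma> s" for X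
    using that by (simp add: degree_eq_card_letters card_mono finite_letters)
  have "degree \<Gamma> s \<ge> 2" using le[of "{b, c}"] s c bc by auto
  then have "s \<noteq> base \<Gamma>" using degree_base[OF assms(1)] by auto
  then have "degree \<Gamma> s = 2" and "z \<noteq> []" using degree_tail st s by auto
  then obtain z' y where z: "z = z' @ [y]" by (metis append_butlast_last_id)
  have "bar y \<in> letters \<Gamma> s"
    using s z by (auto simp: walk_append letters_def)
  moreover have "b \<noteq> bar y" "c \<noteq> bar y"
    using assms(2,3) u v z by (auto simp: reduced_append_iff reduced_Cons_iff)
  ultimately show False
    using le[of "{b, c, bar y}"] s c bc \<open>degree \<Gamma> s = 2\<close> by auto
qed

lemma tail_exit_word:
  assumes "r \<in> tail \<Gamma>" "p \<notin> tail \<Gamma>" "edge_step \<Gamma> r x p"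
  shows "\<exists>w. reduced (w @ [x]) \<and> walk \<Gamma> (base \<Gamma>) w r \<and> walk \<Gamma> (base \<Gamma>) (w @ [x]) p \<and>
           (\<forall>u r. strict_prefix u (w @ [x]) \<longrightarrow> walk \<Gamma> (base \<Gamma>) u r \<longrightarrow> r \<in> tail \<Gamma>)"
proof -
  obtain w where w: "reduced w" "walk \<Gamma> (base \<Gamma>) w r"
    "\<And>u r. prefix u w \<Longrightarrow> walk \<Gamma> (base \<Gamma>) u r \<Longrightarrow> r \<in> tail \<Gamma>"
    using tail_word[OF assms(1)] by blast
  have "last w \<noteq> bar x" if ne: "w \<noteq> []"
  proof
    assume "last w = bar x"
    then obtain v where v: "w = v @ [bar x]" using ne by (metis append_butlast_last_id)
    then have "walk \<Gamma> (base \<Gamma>) v p"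
      using w by (auto simp: walk_append dest: edge_step_unique[OF assms(3)])
    then show False using w(3) v assms(2) by auto
  qed
  then have "reduced (w @ [x])" using w by (auto simp: reduced_append_iff reduced_Cons_iff bar_swap)
  moreover have "walk \<Gamma> (base \<Gamma>) (w @ [x]) p"
    using w assms(3) edge_step_verts by (auto simp: walk_append)
  moreover have "strict_prefix u (w @ [x]) \<Longrightarrow> prefix u w" for u
    by (auto simp: strict_prefix_def)
  ultimately show ?thesis using w by blast
qed

text \<open>The two access words, continued by the exit letters, are comparable. A strict prefix of
  either ends in the tail, while both words end outside it, so they are equal.\<close>

lemma tail_exit_unique:
  assumes "\<not> cyclically_reduced \<Gamma>"
    and "r \<in> tail \<Gamma>" "p \<notin> tail \<Gamma>" "edge_step \<Gamma> r x p"
    and "s \<in> tail \<Gamma>" "q \<notin> tail \<Gamma>" "edge_step \<Gamma> s y q"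
  shows "r = s \<and> x = y \<and> p = q"
proof -
  obtain u where u: "reduced (u @ [x])" "walk \<Gamma> (base \<Gamma>) u r" "walk \<Gamma> (base \<Gamma>) (u @ [x]) p"
    "\<And>z r. strict_prefix z (u @ [x]) \<Longrightarrow> walk \<Gamma> (base \<Gamma>) z r \<Longrightarrow> r \<in> tail \<Gamma>"
    using tail_exit_word[OF assms(2-4)] by blast
  obtain v where v: "reduced (v @ [y])" "walk \<Gamma> (base \<Gamma>) v s" "walk \<Gamma> (base \<Gamma>) (v @ [y]) q"
    "\<And>z r. strict_prefix z (v @ [y]) \<Longrightarrow> walk \<Gamma> (base \<Gamma>) z r \<Longrightarrow> r \<in> tail \<Gamma>"
    using tail_exit_word[OF assms(5-7)] by blast
  have "\<not> strict_prefix (u @ [x]) (v @ [y])" "\<not> strict_prefix (v @ [y]) (u @ [x])"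
    using u v assms(3,6) by blast+
  moreover have "prefix (u @ [x]) (v @ [y]) \<or> prefix (v @ [y]) (u @ [x])"
    by (rule tail_walks_comparable[OF assms(1) u(1) v(1) u(3) v(3)]) (rule u(4))
  ultimately have "u @ [x] = v @ [y]"
    by (auto simp: strict_prefix_def)
  then show ?thesis using u v walk_unique by (metis append1_eq_conv)
qed

text \<open>Here \<open>y\<close> is a forbidden letter, in use the inverse of the letter just read.
  If \<open>p\<close> has a neighbour in the tail, then \<open>p\<close> has degree at least 3,
  since degree 2 would put it into the tail. As only one edge leaves the tail, a third letter leads
  into the core.\<close>

lemma core_letter:
  assumes "p \<in> verts (core \<Gamma>)"
  shows "\<exists>x q. x \<noteq> y \<and> edge_step (core \<Gamma>) p x q"
proof (cases "\<exists>x q. edge_step \<Gamma> p x q \<and> q \<notin> verts (core \<Gamma>)")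
  case False
  have "degree \<Gamma> p \<ge> 2"
    using assms degree_ge tail.base
    by (cases "p = base \<Gamma>") (auto simp: verts_core cyclically_reduced_def split: if_splits)
  then have "\<not> letters \<Gamma> p \<subseteq> {y}"
    using card_mono[of "{y}" "letters \<Gamma> p"] by (auto simp: degree_eq_card_letters)
  then show ?thesis using False assms by (auto simp: letters_def edge_step_core_iff)
next
  case True
  then obtain x r where x: "edge_step \<Gamma> p x r" "r \<notin> verts (core \<Gamma>)" by blast
  then have t: "\<not> cyclically_reduced \<Gamma>" "r \<in> tail \<Gamma>"
    using not_coreD edge_step_verts by blast+
  then have p: "p \<notin> tail \<Gamma>" using assms by (simp add: verts_core)
  have "degree \<Gamma> p \<noteq> 2"
    using p tail.step[OF t(2), of "bar x" p] x by auto
  moreover have "degree \<Gamma> p \<ge> 2"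
    using p degree_ge[of p] tail.base core_verts assms by blast
  ultimately have "card (letters \<Gamma> p) > 2" by (simp add: degree_eq_card_letters)
  moreover have "card {x, y} \<le> 2" by (cases "x = y") auto
  ultimately have "\<not> letters \<Gamma> p \<subseteq> {x, y}"
    using card_mono[of "{x, y}" "letters \<Gamma> p"] by auto
  then obtain z q where z: "z \<noteq> x" "z \<noteq> y" "edge_step \<Gamma> p z q" by (auto simp: letters_def)
  have "q \<in> verts (core \<Gamma>)"
  proof (rule ccontr)
    assume "q \<notin> verts (core \<Gamma>)"
    then have "q \<in> tail \<Gamma>" using z not_coreD edge_step_verts by blast
    then have "bar z = bar x"
      using tail_exit_unique[OF t(1) \<open>q \<in> tail \<Gamma>\<close> p _ t(2) p, of "bar z" "bar x"] z x by auto
    then show False using z by simp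
  qed
  then show ?thesis using z assms by (auto simp: edge_step_core_iff)
qed

section \<open>Prolonging core walks to periodic ones\<close>

lemma finite_entering: "finite {(q, x). \<exists>p. edge_step \<Gamma> p x q}"
proof (rule finite_subset)
  show "{(q, x). \<exists>p. edge_step \<Gamma> p x q} \<subseteq>
    (\<lambda>(p, a, q). (q, Inl a)) ` edges \<Gamma> \<union> (\<lambda>(p, a, q). (p, Inr a)) ` edges \<Gamma>"
  proof safe
    fix q x p assume *: "edge_step \<Gamma> p x q" "(q, x) \<notin> (\<lambda>(p, a, q). (p, Inr a)) ` edges \<Gamma>"
    then show "(q, x) \<in> (\<lambda>(p, a, q). (q, Inl a)) ` edges \<Gamma>"
      by (cases x) force+
  qed
qed (use finite_edges in auto)

lemma core_walk_extend:
  assumes "walk (core \<Gamma>) p w q" "reduced w"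
  shows "\<exists>u c r. prefix w u \<and> c \<noteq> [] \<and> reduced (u @ c) \<and> reduced (c @ c) \<and>
           walk (core \<Gamma>) p u r \<and> walk (core \<Gamma>) r c r"
proof -
  define next_state where
    "next_state = (\<lambda>(q, y). SOME t. snd t \<noteq> bar y \<and> edge_step (core \<Gamma>) q (snd t) (fst t))"
  have nxt: "snd (next_state (q, y)) \<noteq> bar y \<and>
      edge_step (core \<Gamma>) q (snd (next_state (q, y))) (fst (next_state (q, y)))"
    if q: "q \<in> verts (core \<Gamma>)" for q and y :: "'a + 'a"
  proof -
    obtain x r where "x \<noteq> bar y \<and> edge_step (core \<Gamma>) q x r" using core_letter[OF q] by blast
    then show ?thesis
      unfolding next_state_def split
      by (intro someI[of "\<lambda>t. snd t \<noteq> bar y \<and> edge_step (core \<Gamma>) q (snd t) (fst t)" "(r, x)"]) simp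
  qed
  \<comment> \<open>A state is a vertex with the letter last read, so that the next letter can avoid
    cancellation. For empty \<open>w\<close> the value \<open>last w\<close> is an arbitrary letter,
    which merely excludes one choice for the first step.\<close>
  define s where "s = (\<lambda>i. (next_state ^^ i) (q, last w))"
  have s0: "s 0 = (q, last w)" and s_Suc: "s (Suc i) = next_state (s i)" for i
    by (simp_all add: s_def)
  have sv: "fst (s i) \<in> verts (core \<Gamma>)" for i
  proof (induction i)
    case 0
    then show ?case using assms walk_target by (auto simp: s0)
  next
    case (Suc i)
    then show ?case
      using nxt[of "fst (s i)" "snd (s i)"] core.edge_step_verts by (auto simp: s_Suc)
  qed
  have step: "snd (s (Suc i)) \<noteq> bar (snd (s i))"
    "edge_step (core \<Gamma>) (fst (s i)) (snd (s (Suc i))) (fst (s (Suc i)))" for i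
    using nxt[OF sv[of i], of "snd (s i)"] by (auto simp: s_Suc)
  define z where "z = (\<lambda>i j. map (\<lambda>k. snd (s k)) [Suc i..<Suc j])"
  have z_self [simp]: "z i i = []" for i by (simp add: z_def)
  have z_Suc: "z i (Suc j) = z i j @ [snd (s (Suc j))]" if "i \<le> j" for i j
    using that by (simp add: z_def)
  have z_append: "z 0 i @ z i j = z 0 j" if "i \<le> j" for i j
    using that by (induction rule: dec_induct) (auto simp: z_Suc simp flip: append_assoc)
  have walk_z: "walk (core \<Gamma>) (fst (s i)) (z i j) (fst (s j))" if "i \<le> j" for i j
    using that sv step(2)
    by (induction rule: dec_induct) (auto simp: z_Suc walk_append)
  have last_z: "last (v @ z i j) = snd (s j)" if "i < j" for i j v
    using that by (cases j) (auto simp: z_Suc)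
  have red: "reduced (w @ z 0 j)" for j
  proof (induction j)
    case (Suc j)
    have "last (w @ z 0 j) = snd (s j)"
      by (cases "j = 0") (auto simp: s0 last_z)
    then show ?case
      using Suc step(1)[of j] reduced_append_iff[of "w @ z 0 j" "[snd (s (Suc j))]"]
      by (auto simp: z_Suc reduced_Cons_iff)
  qed (use assms in simp)
  \<comment> \<open>The initial state is left out: its letter need not label an edge into
    \<open>q\<close> when \<open>w\<close> is empty.\<close>
  have "range (\<lambda>i. s (Suc i)) \<subseteq> {(q, x). \<exists>p. edge_step \<Gamma> p x q}"
    using step(2) by (auto simp: edge_step_core_iff image_iff) (metis prod.collapse prod.inject)
  then have "\<not> inj (\<lambda>i. s (Suc i))"
    using finite_entering finite_subset finite_imageD infinite_UNIV_nat by blast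
  then obtain i j where "i < j" and "s (Suc i) = s (Suc j)"
    by (metis injI linorder_neqE_nat)
  then obtain i j where ij: "0 < i" "i < j" and e: "s i = s j"
    using Suc_mono zero_less_Suc by blast
  have w0: "walk (core \<Gamma>) p (w @ z 0 i) (fst (s i))"
    using assms walk_z[of 0 i] by (auto simp: walk_append s0)
  have hd: "hd (z i j) = snd (s (Suc i))" and ne: "z i j \<noteq> []"
    using ij by (simp_all add: z_def hd_map del: upt_Suc)
  have "reduced ((w @ z 0 i) @ z i j)" using red[of j] z_append[of i j] ij by simp
  \<comment> \<open>The repeated state includes the letter: the loop ends with the same letter that
    precedes its first one, so that first letter does not cancel at the junction either.\<close>
  moreover have "reduced (z i j @ z i j)"
    using calculation hd ne last_z[OF ij(2), of "[]"] step(1)[of i] e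
    by (auto simp: reduced_append_iff simp del: append_assoc)
  ultimately show ?thesis
    using w0 walk_z[of i j] e ij ne by (intro exI[of _ "w @ z 0 i"] exI[of _ "z i j"]) auto
qed

end

section \<open>Existence of the Stallings graph\<close>

lemma (in group) r_coset_eqI:
  assumes "subgroup H G" "x \<in> carrier G" "y \<in> carrier G" "x \<otimes> inv y \<in> H"
  shows "H #> x = H #> y"
proof -
  have "x = (x \<otimes> inv y) \<otimes> y" using assms by (simp add: m_assoc)
  then have "x \<in> H #> y" using assms(4) unfolding r_coset_def by blast
  then show ?thesis using repr_independence[OF _ assms(3,1)] by blast
qed

lemma (in group) r_coset_mult_left:
  assumes "subgroup H G" "h \<in> H" "x \<in> carrier G"
  shows "H #> (h \<otimes> x) = H #> x"
  using assms by (intro r_coset_eqI) (auto simp: m_assoc subgroup.mem_carrier)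

text \<open>The part of the Schreier coset graph of \<open>H\<close> that is visited by the elements of \<open>H\<close>.\<close>

definition schreier_core :: "'a set \<Rightarrow> 'a gword set \<Rightarrow> ('a gword set, 'a) pointed_lgraph" where
  "schreier_core A H =
     \<lparr>verts = {H #>\<^bsub>free_group A\<^esub> u | u v. u @ v \<in> H},
      edges = {(H #>\<^bsub>free_group A\<^esub> u, a, H #>\<^bsub>free_group A\<^esub> (u @ [Inl a])) | u a v. u @ Inl a # v \<in> H},
      base = H\<rparr>"

locale free_subgroup =
  fixes A :: "'a set" and H :: "'a gword set"
  assumes subgroup_H: "subgroup H (free_group A)"
begin

abbreviation "F \<equiv> free_group A"

sublocale F: group F
  by (rule group_free_group)

lemma mem_H_carrier: "h \<in> H \<Longrightarrow> h \<in> carrier F"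
  using subgroup.mem_carrier[OF subgroup_H] .

lemma append_mem_H:
  assumes "u @ v \<in> H"
  shows "u \<in> carrier F" "v \<in> carrier F" "u \<otimes>\<^bsub>F\<^esub> v = u @ v" "winv v @ winv u \<in> H"
proof -
  have uv: "u @ v \<in> carrier F" using mem_H_carrier assms .
  then show "u \<in> carrier F" "v \<in> carrier F" "u \<otimes>\<^bsub>F\<^esub> v = u @ v"
    by (auto simp: carrier_free_group reduced_append_iff mult_free_group free_reduce_reduced)
  show "winv v @ winv u \<in> H"
    using subgroup.m_inv_closed[OF subgroup_H assms] inv_free_group[OF uv] by (simp add: winv_append)
qed

text \<open>The product of \<open>u\<close> with the inverse of \<open>winv v\<close> is
  \<open>u @ v\<close>. Thus an element of \<open>H\<close> and its inverse pass through the same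
  cosets, which handles edges read backwards.\<close>

lemma coset_winv:
  assumes "u @ v \<in> H"
  shows "H #>\<^bsub>F\<^esub> u = H #>\<^bsub>F\<^esub> winv v"
proof (rule F.r_coset_eqI[OF subgroup_H])
  show "u \<in> carrier F" "winv v \<in> carrier F" using append_mem_H[OF assms] winv_carrier by auto
  show "u \<otimes>\<^bsub>F\<^esub> inv\<^bsub>F\<^esub> (winv v) \<in> H"
    using append_mem_H[OF assms] inv_free_group[OF winv_carrier[OF append_mem_H(2)[OF assms]]] assms
    by simp
qed

lemma coset_base: "H #>\<^bsub>F\<^esub> [] = H"
  using F.coset_mult_one[OF subgroup.subset[OF subgroup_H]] by (simp add: one_free_group)

lemma coset_mem: "h \<in> H \<Longrightarrow> H #>\<^bsub>F\<^esub> h = H"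
  using F.coset_join2[OF _ subgroup_H] mem_H_carrier by blast

lemma coset_memD:
  assumes "h \<in> carrier F" "H #>\<^bsub>F\<^esub> h = H"
  shows "h \<in> H"
  using F.coset_join1[OF assms(2,1) subgroup_H] .

lemma verts_schreier_core:
  "P \<in> verts (schreier_core A H) \<longleftrightarrow> (\<exists>u v. u @ v \<in> H \<and> P = H #>\<^bsub>F\<^esub> u)"
  by (auto simp: schreier_core_def)

lemma schreier_edge_stepI:
  assumes "u @ x # v \<in> H"
  shows "edge_step (schreier_core A H) (H #>\<^bsub>F\<^esub> u) x (H #>\<^bsub>F\<^esub> (u @ [x]))"
proof (cases x)
  case (Inl a)
  then show ?thesis using assms by (auto simp: schreier_core_def)
next
  case (Inr a)
  \<comment> \<open>Edges are listed for positive letters only; this one is found in the inverse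
    element \<open>winv v @ Inl a # winv u\<close>.\<close>
  have 1: "H #>\<^bsub>F\<^esub> (u @ [x]) = H #>\<^bsub>F\<^esub> winv v"
    using coset_winv[of "u @ [x]" v] assms by simp
  have 2: "H #>\<^bsub>F\<^esub> u = H #>\<^bsub>F\<^esub> (winv v @ [Inl a])"
    using coset_winv[of u "x # v"] assms Inr by (simp add: winv_Cons)
  have "winv v @ Inl a # winv u \<in> H"
    using append_mem_H(4)[OF assms] Inr by (simp add: winv_Cons)
  then show ?thesis
    unfolding 1 2 unfolding Inr by (auto simp: schreier_core_def)
qed

lemma schreier_edgeD:
  assumes "edge_step (schreier_core A H) P x Q"
  shows "x \<in> A <+> A \<and> (\<exists>u v. u @ x # v \<in> H \<and> P = H #>\<^bsub>F\<^esub> u \<and> Q = H #>\<^bsub>F\<^esub> (u @ [x]))"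
proof -
  have "\<exists>u v. u @ x # v \<in> H \<and> P = H #>\<^bsub>F\<^esub> u \<and> Q = H #>\<^bsub>F\<^esub> (u @ [x])"
  proof (cases x)
    case (Inl a)
    then show ?thesis using assms by (auto simp: schreier_core_def)
  next
    case (Inr a)
    then obtain u v where u: "u @ Inl a # v \<in> H" "Q = H #>\<^bsub>F\<^esub> u" "P = H #>\<^bsub>F\<^esub> (u @ [Inl a])"
      using assms by (auto simp: schreier_core_def)
    have "winv v @ x # winv u \<in> H"
      using append_mem_H(4)[OF u(1)] Inr by (simp add: winv_Cons)
    moreover have "P = H #>\<^bsub>F\<^esub> winv v" "Q = H #>\<^bsub>F\<^esub> (winv v @ [x])"
      using coset_winv[of u "Inl a # v"] coset_winv[of "u @ [Inl a]" v] u Inr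
      by (auto simp: winv_Cons)
    ultimately show ?thesis by blast
  qed
  moreover have "x \<in> A <+> A" if "u @ x # v \<in> H" for u v
    using mem_H_carrier[OF that] by (simp add: carrier_free_group del: Plus_def)
  ultimately show ?thesis by blast
qed

lemma schreier_edge_step_coset:
  assumes "edge_step (schreier_core A H) P x Q"
  shows "[x] \<in> carrier F" "Q = P #>\<^bsub>F\<^esub> [x]" "\<exists>u \<in> carrier F. P = H #>\<^bsub>F\<^esub> u"
proof -
  obtain u v where u: "u @ x # v \<in> H" "P = H #>\<^bsub>F\<^esub> u" "Q = H #>\<^bsub>F\<^esub> (u @ [x])"
    using schreier_edgeD[OF assms] by blast
  show x: "[x] \<in> carrier F"
    using schreier_edgeD[OF assms] by (simp add: carrier_free_group reduced_Cons_iff del: Plus_def)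
  have ux: "u @ [x] \<in> carrier F" "u \<in> carrier F"
    using append_mem_H(1)[of "u @ [x]" v] append_mem_H(1)[OF u(1)] u(1) by auto
  then have "u @ [x] = u \<otimes>\<^bsub>F\<^esub> [x]"
    by (simp add: mult_free_group carrier_free_group free_reduce_reduced)
  then show "Q = P #>\<^bsub>F\<^esub> [x]"
    using F.coset_mult_assoc[OF subgroup.subset[OF subgroup_H] ux(2) x] u by simp
  show "\<exists>u \<in> carrier F. P = H #>\<^bsub>F\<^esub> u" using u ux by blast
qed

lemma schreier_edge_step_unique:
  "edge_step (schreier_core A H) P x Q \<Longrightarrow> edge_step (schreier_core A H) P x Q' \<Longrightarrow> Q = Q'"
  using schreier_edge_step_coset(2) by blast

lemma schreier_walk_prefix:
  assumes "u @ v \<in> H"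
  shows "walk (schreier_core A H) H u (H #>\<^bsub>F\<^esub> u)"
  using assms
proof (induction u arbitrary: v rule: rev_induct)
  case Nil
  have "[] @ [] \<in> H" using subgroup.one_closed[OF subgroup_H] by (simp add: one_free_group)
  then have "\<exists>u v. H = H #>\<^bsub>F\<^esub> u \<and> u @ v \<in> H" using coset_base by metis
  then show ?case by (simp add: coset_base schreier_core_def)
next
  case (snoc x u)
  then have "walk (schreier_core A H) H u (H #>\<^bsub>F\<^esub> u)" by simp
  moreover have "edge_step (schreier_core A H) (H #>\<^bsub>F\<^esub> u) x (H #>\<^bsub>F\<^esub> (u @ [x]))"
    using schreier_edge_stepI[of u x v] snoc.prems by simp
  moreover have "H #>\<^bsub>F\<^esub> u \<in> verts (schreier_core A H)"
    "H #>\<^bsub>F\<^esub> (u @ [x]) \<in> verts (schreier_core A H)"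
    by (simp only: verts_schreier_core, metis append_assoc snoc.prems)+
  ultimately show ?case by (auto simp: walk_append)
qed

lemma schreier_walk_coset:
  assumes "walk (schreier_core A H) (H #>\<^bsub>F\<^esub> u) w Q" "u \<in> carrier F" "reduced (u @ w)"
  shows "Q = H #>\<^bsub>F\<^esub> (u @ w) \<and> u @ w \<in> carrier F"
  using assms
proof (induction w arbitrary: u)
  case (Cons x w)
  then obtain R where R: "edge_step (schreier_core A H) (H #>\<^bsub>F\<^esub> u) x R"
    "walk (schreier_core A H) R w Q"
    by auto
  have ux: "reduced (u @ [x])" using Cons.prems(3) by (simp add: reduced_append_iff reduced_Cons_iff)
  have x: "[x] \<in> carrier F" using schreier_edge_step_coset(1)[OF R(1)] .
  have e: "u \<otimes>\<^bsub>F\<^esub> [x] = u @ [x]" using ux by (simp add: mult_free_group free_reduce_reduced)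
  then have "u @ [x] \<in> carrier F" using F.m_closed[OF Cons.prems(2) x] by simp
  moreover have "R = H #>\<^bsub>F\<^esub> (u @ [x])"
    using schreier_edge_step_coset(2)[OF R(1)] e
      F.coset_mult_assoc[OF subgroup.subset[OF subgroup_H] Cons.prems(2) x] by simp
  ultimately show ?case using Cons.IH[of "u @ [x]"] R Cons.prems by simp
qed auto

text \<open>The finitely many cosets of prefixes of generators and their inverses suffice. A prefix
  of a product \<open>h1 \<otimes> h2\<close> is a prefix of \<open>h1\<close>, or \<open>h1\<close>
  times a prefix of \<open>h2\<close>, and the left factor \<open>h1\<close> from \<open>H\<close>
  does not change the coset.\<close>

lemma finite_schreier_core:
  assumes "finitely_generated F H"
  shows "finite (verts (schreier_core A H))"
proof -
  obtain S where S: "S \<subseteq> carrier F" "finite S" "H = generate F S"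
    using assms by (auto simp: finitely_generated_def)
  define W where "W = (\<lambda>u. H #>\<^bsub>F\<^esub> u) ` (\<Union>s \<in> insert [] (S \<union> winv ` S). set (prefixes s))"
  have W: "H #>\<^bsub>F\<^esub> u \<in> W" if "prefix u s" "s \<in> insert [] (S \<union> winv ` S)" for u s
    using that unfolding W_def by (intro imageI UN_I[of s]) simp_all
  have "H #>\<^bsub>F\<^esub> u \<in> W" if "h \<in> generate F S" "prefix u h" for h u
    using that
  proof (induction arbitrary: u rule: generate.induct)
    case one
    then show ?case using W[of "[]" "[]"] by (simp add: one_free_group)
  next
    case (incl h)
    then show ?case by (intro W[of u h]) auto
  next
    case (inv h)
    then show ?case using S(1) by (intro W[of u "winv h"]) (auto simp: inv_free_group subset_iff)
  next
    case (eng h1 h2)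
    have h: "h1 \<in> H" "h2 \<in> H" "h1 \<in> carrier F" "h2 \<in> carrier F"
      using eng.hyps S(3) mem_H_carrier by auto
    obtain z where z: "prefix z (h1 @ h2)" "free_reduce z = u"
      using prefix_free_reduceD eng.prems by (auto simp: mult_free_group)
    from z(1) consider "prefix z h1" | u' where "z = h1 @ u'" "prefix u' h2"
      by (auto simp: prefix_append)
    then show ?case
    proof cases
      case 1
      then have "reduced z" using h(3) by (auto simp: carrier_free_group prefix_def reduced_append_iff)
      then show ?thesis using eng.IH(1) 1 z(2) by (simp add: free_reduce_reduced)
    next
      case 2
      then have "u' \<in> carrier F" using h(4) by (auto simp: carrier_free_group prefix_def reduced_append_iff)
      moreover have "u = h1 \<otimes>\<^bsub>F\<^esub> u'" using 2 z(2) by (simp add: mult_free_group)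
      ultimately show ?thesis
        using F.r_coset_mult_left[OF subgroup_H h(1)] eng.IH(2) 2 by simp
    qed
  qed
  then have "verts (schreier_core A H) \<subseteq> W"
    using S(3) by (auto simp: schreier_core_def)
  moreover have "finite W" using S(2) by (auto simp: W_def)
  ultimately show ?thesis by (rule finite_subset)
qed

lemma is_stallings_schreier_core:
  assumes "finite A" "finitely_generated F H"
  shows "is_stallings A H (schreier_core A H)"
proof -
  let ?\<Gamma> = "schreier_core A H"
  have fin: "finite (verts ?\<Gamma>)" using finite_schreier_core[OF assms(2)] .
  have e: "edges ?\<Gamma> \<subseteq> verts ?\<Gamma> \<times> A \<times> verts ?\<Gamma>"
  proof
    fix E assume "E \<in> edges ?\<Gamma>"
    then obtain P a Q where E: "E = (P, a, Q)" "(P, a, Q) \<in> edges ?\<Gamma>" by (cases E) auto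
    then have "edge_step ?\<Gamma> P (Inl a) Q" by simp
    from schreier_edgeD[OF this] obtain u v where
      u: "u @ Inl a # v \<in> H" "P = H #>\<^bsub>F\<^esub> u" "Q = H #>\<^bsub>F\<^esub> (u @ [Inl a])" "a \<in> A"
      by auto
    then have "(u @ [Inl a]) @ v \<in> H" by simp
    then have "P \<in> verts ?\<Gamma>" "Q \<in> verts ?\<Gamma>"
      using u(1,2,3) unfolding verts_schreier_core by blast+
    then show "E \<in> verts ?\<Gamma> \<times> A \<times> verts ?\<Gamma>" using u(4) E by simp
  qed
  have red: "reduced_graph ?\<Gamma>"
    using schreier_edge_step_unique[of _ "Inl _"] schreier_edge_step_unique[of _ "Inr _"]
    unfolding reduced_graph_def by simp blast
  interpret folded_graph ?\<Gamma>
    using e red finite_subset[OF e] fin assms(1) by unfold_locales auto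
  have base: "base ?\<Gamma> = H" "H \<in> verts ?\<Gamma>"
    using schreier_walk_prefix[of "[]" "[]"] subgroup.one_closed[OF subgroup_H]
    by (auto simp: schreier_core_def one_free_group)
  have conn: "\<exists>w. walk ?\<Gamma> P w Q" if conn: "P \<in> verts ?\<Gamma>" "Q \<in> verts ?\<Gamma>" for P Q
  proof -
    obtain u u' where "walk ?\<Gamma> H u P" "walk ?\<Gamma> H u' Q"
      using conn schreier_walk_prefix unfolding verts_schreier_core by blast
    then have "walk ?\<Gamma> P (winv u @ u') Q" using walk_winv by (auto simp: walk_append)
    then show ?thesis by blast
  qed
  have deg: "degree ?\<Gamma> P \<ge> 2" if P: "P \<in> verts ?\<Gamma>" "P \<noteq> base ?\<Gamma>" for P
  proof -
    obtain u v where u: "u @ v \<in> H" "P = H #>\<^bsub>F\<^esub> u" using P by (auto simp: verts_schreier_core)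
    \<comment> \<open>Away from the base, an element of \<open>H\<close> passes strictly through
      \<open>P\<close>; the letter back and the letter on differ because the element is
      reduced.\<close>
    have "u \<noteq> []" "v \<noteq> []" using u P base coset_base coset_mem by auto
    then obtain u' x y v' where uv: "u = u' @ [x]" "v = y # v'"
      by (metis append_butlast_last_id list.exhaust)
    have "edge_step ?\<Gamma> (H #>\<^bsub>F\<^esub> u') x P" "edge_step ?\<Gamma> P y (H #>\<^bsub>F\<^esub> (u @ [y]))"
      using schreier_edge_stepI[of u' x v] schreier_edge_stepI[of u y v'] u uv by auto
    then have "{bar x, y} \<subseteq> letters ?\<Gamma> P"
      by (auto simp: letters_def)
    moreover have "y \<noteq> bar x"
      using mem_H_carrier[OF u(1)] uv by (auto simp: carrier_free_group reduced_append_iff reduced_Cons_iff)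
    ultimately show ?thesis
      using card_mono[OF finite_letters, of "{bar x, y}" P] by (simp add: degree_eq_card_letters)
  qed
  have "w \<in> H \<longleftrightarrow> walk ?\<Gamma> H w H" if w: "w \<in> carrier F" for w
  proof
    assume "w \<in> H"
    then show "walk ?\<Gamma> H w H" using schreier_walk_prefix[of w "[]"] coset_mem by simp
  next
    assume "walk ?\<Gamma> H w H"
    then have "H = H #>\<^bsub>F\<^esub> w"
      using schreier_walk_coset[of "[]" w H] w by (simp add: coset_base carrier_free_group)
    then show "w \<in> H" using coset_memD[OF w] by simp
  qed
  then show ?thesis
    using fin e red base conn deg by (simp add: is_stallings_def)
qed

end

section \<open>The quotient of the Stallings graph\<close>

lemma mult3_free_group:
  "u \<otimes>\<^bsub>free_group A\<^esub> v \<otimes>\<^bsub>free_group A\<^esub> w = free_reduce (u @ v @ w)"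
  by (simp add: mult_free_group)

text \<open>A long periodic middle part protects the word before it from cancellation.\<close>

lemma prefix_periodic:
  assumes "v \<in> carrier (free_group A)" "u \<in> carrier (free_group A)" "c \<in> carrier (free_group A)"
    and "z \<in> carrier (free_group A)"
    and "reduced (v @ u @ c)" "reduced (c @ c)" "c \<noteq> []" "(n::nat) > 0"
  shows "\<exists>m::nat. prefix (v @ u) (v \<otimes>\<^bsub>free_group A\<^esub>
           (u \<otimes>\<^bsub>free_group A\<^esub> c \<otimes>\<^bsub>free_group A\<^esub> inv\<^bsub>free_group A\<^esub> u) [^]\<^bsub>free_group A\<^esub> (n * m)
           \<otimes>\<^bsub>free_group A\<^esub> z)"
proof -
  interpret group "free_group A" by (rule group_free_group)
  \<comment> \<open>The word \<open>winv u @ z\<close> behind the periodic block has this length,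
    and the block of \<open>n * m\<close> copies of the nonempty \<open>c\<close> is at least as
    long.\<close>
  define m where "m = length u + length z"
  have "length (winv u @ z) \<le> n * m * length c"
  proof -
    have "m * 1 \<le> m * (n * length c)" using assms(7,8) by (intro mult_le_mono2) (simp add: Suc_leI)
    then show ?thesis by (simp add: m_def mult.commute mult.left_commute)
  qed
  then have "prefix (v @ u) (free_reduce (((v @ u) @ wpow c (n * m)) @ (winv u @ z)))"
    using assms by (intro prefix_free_reduce_append reduced_append_wpow) auto
  moreover have "v \<otimes>\<^bsub>free_group A\<^esub>
           (u \<otimes>\<^bsub>free_group A\<^esub> c \<otimes>\<^bsub>free_group A\<^esub> inv\<^bsub>free_group A\<^esub> u) [^]\<^bsub>free_group A\<^esub> (n * m)
           \<otimes>\<^bsub>free_group A\<^esub> z = free_reduce (v @ free_reduce (u @ wpow c (n * m) @ winv u) @ z)"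
    unfolding conj_pow[OF assms(2,3)] pow_free_group[OF assms(6)]
    using assms(2) by (simp add: mult3_free_group inv_free_group)
  moreover have "free_reduce (v @ free_reduce (u @ wpow c (n * m) @ winv u) @ z) =
      free_reduce (((v @ u) @ wpow c (n * m)) @ (winv u @ z))"
    by (metis free_reduce_append_left free_reduce_append_right append_assoc)
  ultimately show ?thesis by metis
qed

context folded_graph
begin

lemma walk_mult:
  "walk \<Gamma> p u q \<Longrightarrow> walk \<Gamma> q v r \<Longrightarrow> walk \<Gamma> p (u \<otimes>\<^bsub>free_group A\<^esub> v) r"
  unfolding mult_free_group by (rule walk_free_reduce) (auto simp: walk_append)

lemma walk_inv:
  "u \<in> carrier (free_group A) \<Longrightarrow> walk \<Gamma> p u q \<Longrightarrow> walk \<Gamma> q (inv\<^bsub>free_group A\<^esub> u) p"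
  by (simp add: inv_free_group walk_winv)

lemma walk_pow:
  "walk \<Gamma> p u p \<Longrightarrow> walk \<Gamma> p (u [^]\<^bsub>free_group A\<^esub> (n::nat)) p"
  by (induction n) (auto simp: nat_pow_def one_free_group intro: walk_mult walk_source)

end

locale stallings_graph = free_subgroup A H
  for A :: "'a set" and H :: "'a gword set" +
  fixes \<Gamma> :: "('v, 'a) pointed_lgraph"
  assumes finite_A: "finite A"
    and is_stallings: "is_stallings A H \<Gamma>"
begin

lemma edges_subset: "edges \<Gamma> \<subseteq> verts \<Gamma> \<times> A \<times> verts \<Gamma>"
  using is_stallings by (simp add: is_stallings_def)

sublocale pointed_graph \<Gamma>
proof
  show "finite (edges \<Gamma>)"
    using is_stallings finite_A by (auto simp: is_stallings_def intro: finite_subset)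
qed (use is_stallings in \<open>auto simp: is_stallings_def\<close>)

lemma edge_step_letter: "edge_step \<Gamma> p x q \<Longrightarrow> x \<in> A <+> A"
  using edges_subset by (cases x) auto

lemma walk_carrier:
  assumes "walk \<Gamma> p w q" "reduced w"
  shows "w \<in> carrier F"
proof -
  have "w \<in> lists (A <+> A)"
    using assms(1) by (induction w arbitrary: p) (auto dest: edge_step_letter simp del: Plus_def)
  then show ?thesis using assms by (simp add: carrier_free_group del: in_lists_conv_set)
qed

lemma H_iff: "w \<in> H \<longleftrightarrow> w \<in> carrier F \<and> walk \<Gamma> (base \<Gamma>) w (base \<Gamma>)"
  using is_stallings subgroup.mem_carrier[OF subgroup_H] by (auto simp: is_stallings_def)

lemma connected_carrier:
  assumes "p \<in> verts \<Gamma>" "q \<in> verts \<Gamma>"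
  shows "\<exists>t \<in> carrier F. walk \<Gamma> p t q"
  using connected[OF assms] walk_free_reduce walk_carrier reduced_free_reduce by blast

text \<open>Change of base point: this allows working at a core vertex although the base may lie on
  the tail.\<close>

lemma loop_iff:
  assumes "t \<in> carrier F" "walk \<Gamma> (base \<Gamma>) t p" "y \<in> carrier F"
  shows "walk \<Gamma> p y p \<longleftrightarrow> t \<otimes>\<^bsub>F\<^esub> y \<otimes>\<^bsub>F\<^esub> inv\<^bsub>F\<^esub> t \<in> H"
proof
  assume "walk \<Gamma> p y p"
  then show "t \<otimes>\<^bsub>F\<^esub> y \<otimes>\<^bsub>F\<^esub> inv\<^bsub>F\<^esub> t \<in> H"
    using assms walk_mult[OF walk_mult[OF assms(2)] walk_inv[OF assms(1,2)]] by (simp add: H_iff)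
next
  assume "t \<otimes>\<^bsub>F\<^esub> y \<otimes>\<^bsub>F\<^esub> inv\<^bsub>F\<^esub> t \<in> H"
  then have "walk \<Gamma> (base \<Gamma>) (t \<otimes>\<^bsub>F\<^esub> y \<otimes>\<^bsub>F\<^esub> inv\<^bsub>F\<^esub> t) (base \<Gamma>)"
    by (simp add: H_iff)
  then have "walk \<Gamma> p (inv\<^bsub>F\<^esub> t \<otimes>\<^bsub>F\<^esub> (t \<otimes>\<^bsub>F\<^esub> y \<otimes>\<^bsub>F\<^esub> inv\<^bsub>F\<^esub> t) \<otimes>\<^bsub>F\<^esub> t) p"
    by (rule walk_mult[OF walk_mult[OF walk_inv[OF assms(1,2)]] assms(2)])
  moreover have "inv\<^bsub>F\<^esub> t \<otimes>\<^bsub>F\<^esub> (t \<otimes>\<^bsub>F\<^esub> y \<otimes>\<^bsub>F\<^esub> inv\<^bsub>F\<^esub> t) \<otimes>\<^bsub>F\<^esub> t = y"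
    using assms by (simp add: F.m_assoc F.inv_mult_cancel)
  ultimately show "walk \<Gamma> p y p" by simp
qed

section \<open>Languages of core vertices\<close>

lemma core_langI: "reduced w \<Longrightarrow> walk (core \<Gamma>) p w q \<Longrightarrow> w \<in> core_lang \<Gamma> p"
  unfolding core_lang_def by blast

lemma core_lang_prefix:
  assumes "reduced w" "walk \<Gamma> p w q" "p \<in> verts (core \<Gamma>)" "q \<in> verts (core \<Gamma>)" "prefix u w"
  shows "\<exists>r. walk (core \<Gamma>) p u r" "u \<in> core_lang \<Gamma> p"
proof -
  have "walk (core \<Gamma>) p w q" using walk_core_iff assms by blast
  then show "\<exists>r. walk (core \<Gamma>) p u r" using assms(5) by (auto simp: prefix_def walk_append)
  then show "u \<in> core_lang \<Gamma> p"
    using assms(1,5) by (auto simp: core_lang_def prefix_def reduced_append_iff)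
qed

text \<open>A word that does not begin with \<open>bar x\<close> can be read from \<open>p\<close>
  after \<open>x\<close>. A word \<open>bar x # u\<close> first returns to \<open>p\<close>, so
  \<open>u\<close> itself is read there. In both cases the word found at \<open>p'\<close> is moved
  back across the edge to \<open>q'\<close>.\<close>

lemma core_lang_step_mono:
  assumes "core_lang \<Gamma> p \<subseteq> core_lang \<Gamma> p'" "edge_step (core \<Gamma>) p x q" "edge_step (core \<Gamma>) p' x q'"
  shows "core_lang \<Gamma> q \<subseteq> core_lang \<Gamma> q'"
proof
  fix w assume w: "w \<in> core_lang \<Gamma> q"
  then obtain r where r: "reduced w" "walk (core \<Gamma>) q w r" by (auto simp: core_lang_def)
  have v: "p \<in> verts (core \<Gamma>)" "q' \<in> verts (core \<Gamma>)"
    using assms core.edge_step_verts by blast+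
  show "w \<in> core_lang \<Gamma> q'"
  proof (cases "w = [] \<or> hd w \<noteq> bar x")
    case True
    then have "x # w \<in> core_lang \<Gamma> p"
      using r assms(2) v by (intro core_langI[of _ _ r]) (auto simp: reduced_Cons_iff)
    then have "x # w \<in> core_lang \<Gamma> p'" using assms(1) by blast
    then obtain s r' where s: "edge_step (core \<Gamma>) p' x r'" "walk (core \<Gamma>) r' w s"
      by (auto simp: core_lang_def)
    then have "r' = q'" using core.edge_step_unique assms(3) by blast
    then show ?thesis using r(1) s(2) core_langI by blast
  next
    case False
    then obtain u where u: "w = bar x # u" by (cases w) auto
    then have "walk (core \<Gamma>) p u r"
      using r(2) by (auto dest: core.edge_step_unique_source[OF assms(2)])
    then have "u \<in> core_lang \<Gamma> p'"
      using r(1) u assms(1) by (auto simp: core_lang_def reduced_Cons_iff)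
    then obtain s where "walk (core \<Gamma>) p' u s" by (auto simp: core_lang_def)
    then show ?thesis
      using r(1) u assms(3) v by (intro core_langI[of _ _ s]) auto
  qed
qed

lemma core_lang_step:
  assumes "core_lang \<Gamma> p = core_lang \<Gamma> p'" "edge_step (core \<Gamma>) p x q"
  shows "\<exists>q'. edge_step (core \<Gamma>) p' x q' \<and> core_lang \<Gamma> q = core_lang \<Gamma> q'"
proof -
  have "[x] \<in> core_lang \<Gamma> p"
    using assms(2) core.edge_step_verts[OF assms(2)]
    by (intro core_langI[of _ _ q]) (auto simp: reduced_Cons_iff)
  then have "[x] \<in> core_lang \<Gamma> p'" using assms(1) by simp
  then obtain q' where "edge_step (core \<Gamma>) p' x q'" by (auto simp: core_lang_def)
  then show ?thesis using core_lang_step_mono assms by (metis subset_antisym subset_refl)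
qed

section \<open>Vertex classes and foldedness of the quotient\<close>

definition cls :: "'v \<Rightarrow> 'v set" where
  "cls p = core_equiv \<Gamma> `` {p}"

abbreviation \<Delta> :: "('v set, 'a) pointed_lgraph" where
  "\<Delta> \<equiv> quotient_graph \<Gamma> (core_equiv \<Gamma>)"

lemma cls_eq_iff:
  "p \<in> verts \<Gamma> \<Longrightarrow> q \<in> verts \<Gamma> \<Longrightarrow> cls p = cls q \<longleftrightarrow>
     p = q \<or> p \<in> verts (core \<Gamma>) \<and> q \<in> verts (core \<Gamma>) \<and> core_lang \<Gamma> p = core_lang \<Gamma> q"
  using eq_equiv_class_iff[OF equiv_core_equiv[of \<Gamma>]] unfolding cls_def
  by (auto simp: core_equiv_def)

lemma base_quotient: "base \<Delta> = cls (base \<Gamma>)"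
  by (simp add: quotient_graph_def cls_def)

lemma verts_quotient: "verts \<Delta> = cls ` verts \<Gamma>"
  by (auto simp: quotient_graph_def cls_def quotient_def)

lemma edge_step_quotient:
  "edge_step \<Delta> P x Q \<longleftrightarrow> (\<exists>p q. P = cls p \<and> Q = cls q \<and> edge_step \<Gamma> p x q)"
  by (cases x) (auto simp: quotient_graph_def cls_def)

lemma cls_step_unique:
  assumes "edge_step \<Gamma> p x q" "edge_step \<Gamma> p' x q'" "cls p = cls p'"
  shows "cls q = cls q'"
proof (cases "p = p'")
  case True
  then show ?thesis using assms edge_step_unique by blast
next
  case False
  have v: "p \<in> verts \<Gamma>" "q \<in> verts \<Gamma>" "p' \<in> verts \<Gamma>" "q' \<in> verts \<Gamma>"
    using assms edge_step_verts by blast+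
  then have p: "p \<in> verts (core \<Gamma>)" "p' \<in> verts (core \<Gamma>)" "core_lang \<Gamma> p = core_lang \<Gamma> p'"
    using assms(3) False by (auto simp: cls_eq_iff)
  have in_core: "cls q = cls q'" if ass: "q \<in> verts (core \<Gamma>)"
    "p \<in> verts (core \<Gamma>)" "p' \<in> verts (core \<Gamma>)" "core_lang \<Gamma> p = core_lang \<Gamma> p'"
    "edge_step \<Gamma> p x q" "edge_step \<Gamma> p' x q'" for p p' q q'
  proof -
    have "edge_step (core \<Gamma>) p x q" using ass by (simp add: edge_step_core_iff)
    then obtain r where r: "edge_step (core \<Gamma>) p' x r" "core_lang \<Gamma> q = core_lang \<Gamma> r"
      using core_lang_step[OF ass(4)] by blast
    then have "r = q'" using ass edge_step_unique by (auto simp: edge_step_core_iff)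
    then show ?thesis
      using ass r core_verts core.edge_step_verts by (metis cls_eq_iff)
  qed
  show ?thesis
  proof (cases "q \<in> verts (core \<Gamma>) \<or> q' \<in> verts (core \<Gamma>)")
    case True
    then show ?thesis
      using in_core[of q p p' q'] in_core[of q' p' p q] p assms by auto
  next
    case out: False
    then have t: "\<not> cyclically_reduced \<Gamma>" "q \<in> tail \<Gamma>" "q' \<in> tail \<Gamma>"
      using not_coreD v by blast+
    then have "p \<notin> tail \<Gamma>" "p' \<notin> tail \<Gamma>" using p by (auto simp: verts_core)
    then show ?thesis
      using tail_exit_unique[OF t(1) t(2) _ _ t(3), of p "bar x" p' "bar x"] assms by simp
  qed
qed

lemma walk_quotient: "walk \<Gamma> p w q \<Longrightarrow> walk \<Delta> (cls p) w (cls q)"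
  by (induction w arbitrary: p) (auto simp: verts_quotient edge_step_quotient)

sublocale quot: pointed_graph \<Delta>
proof unfold_locales
  show "edges \<Delta> \<subseteq> verts \<Delta> \<times> UNIV \<times> verts \<Delta>"
    using edges_verts by (auto simp: quotient_graph_def intro!: quotientI)
  have "edges \<Delta> = (\<lambda>(p, a, q). (cls p, a, cls q)) ` edges \<Gamma>"
    by (force simp: quotient_graph_def cls_def)
  then show "finite (edges \<Delta>)" using finite_edges by simp
  have "Q = Q'" if steps: "edge_step \<Delta> P x Q" "edge_step \<Delta> P x Q'" for P x Q Q'
  proof -
    obtain p q p' q' where "P = cls p" "Q = cls q" "edge_step \<Gamma> p x q"
      "P = cls p'" "Q' = cls q'" "edge_step \<Gamma> p' x q'"
      using steps unfolding edge_step_quotient by blast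
    then show ?thesis using cls_step_unique[of p x q p' q'] by simp
  qed
  from this[of _ "Inl _"] this[of _ "Inr _"] show "reduced_graph \<Delta>"
    unfolding reduced_graph_def by simp blast
  then interpret D: folded_graph \<Delta>
    using \<open>finite (edges \<Delta>)\<close> \<open>edges \<Delta> \<subseteq> _\<close> by unfold_locales
  show "finite (verts \<Delta>)" "base \<Delta> \<in> verts \<Delta>"
    using finite_verts base_verts by (auto simp: verts_quotient base_quotient)
  show "\<exists>w. walk \<Delta> P w Q" if "P \<in> verts \<Delta>" "Q \<in> verts \<Delta>" for P Q
    using that connected walk_quotient by (force simp: verts_quotient)
  show "degree \<Delta> P \<ge> 2" if P: "P \<in> verts \<Delta>" "P \<noteq> base \<Delta>" for P
  proof -
    obtain p where p: "p \<in> verts \<Gamma>" "P = cls p" "p \<noteq> base \<Gamma>"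
      using P by (auto simp: verts_quotient base_quotient)
    \<comment> \<open>Identification keeps every letter at \<open>p\<close>, and foldedness turns
      letters into degree.\<close>
    have "letters \<Gamma> p \<subseteq> letters \<Delta> P"
      using p by (auto simp: letters_def edge_step_quotient)
    then have "degree \<Gamma> p \<le> card (letters \<Delta> P)"
      by (simp add: degree_eq_card_letters card_mono D.finite_letters)
    then show ?thesis using degree_ge[of p] p by (simp add: D.degree_eq_card_letters)
  qed
qed

section \<open>Lifting walks from the quotient\<close>

lemma cls_not_core: "p \<in> verts \<Gamma> \<Longrightarrow> q \<in> verts \<Gamma> \<Longrightarrow> p \<notin> verts (core \<Gamma>) \<Longrightarrow> cls p = cls q \<Longrightarrow> p = q"
  by (auto simp: cls_eq_iff)

text \<open>A tail vertex is alone in its class, so the next edge can be taken at the vertex reached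
  so far. The condition on the first letter keeps the walk on the tail.\<close>

lemma lift_tail_walk:
  assumes "\<not> cyclically_reduced \<Gamma>" "r \<in> tail \<Gamma>"
    and x: "\<And>w q. reduced w \<Longrightarrow> walk \<Gamma> r w q \<Longrightarrow> w = [] \<or> hd w \<noteq> x \<Longrightarrow> q \<in> tail \<Gamma>"
    and "walk \<Delta> (cls r) w Q" "reduced w" "w = [] \<or> hd w \<noteq> x"
  shows "\<exists>q \<in> tail \<Gamma>. Q = cls q \<and> walk \<Gamma> r w q"
  using assms(4-6)
proof (induction w arbitrary: Q rule: rev_induct)
  case Nil
  then show ?case using assms(2) tail_verts by auto
next
  case (snoc y w)
  then obtain R where R: "walk \<Delta> (cls r) w R" "edge_step \<Delta> R y Q"
    by (auto simp: walk_append)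
  obtain s where s: "s \<in> tail \<Gamma>" "R = cls s" "walk \<Gamma> r w s"
    using snoc.IH[OF R(1)] snoc.prems by (cases "w = []") (auto simp: reduced_append_iff)
  obtain s' q where q: "R = cls s'" "Q = cls q" "edge_step \<Gamma> s' y q"
    using R(2) by (auto simp: edge_step_quotient)
  have "s \<notin> verts (core \<Gamma>)" using s(1) assms(1) by (simp add: verts_core)
  then have "s = s'"
    using cls_not_core[of s s'] s q tail_verts edge_step_verts by auto
  then have "walk \<Gamma> r (w @ [y]) q" using s q edge_step_verts by (auto simp: walk_append)
  then show ?case using x[of "w @ [y]" q] snoc.prems q by auto
qed

text \<open>Inside the core, equal languages permit a change of representative before each letter. A
  walk that left the core would end in the tail, whose classes contain no core vertex. The lift ends
  somewhere in the class of \<open>q\<close>, not necessarily at \<open>q\<close>.\<close>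

lemma lift_core_walk:
  assumes "p \<in> verts (core \<Gamma>)" "q \<in> verts (core \<Gamma>)" "reduced w" "walk \<Delta> (cls p) w (cls q)"
  shows "\<exists>q'. walk \<Gamma> p w q' \<and> cls q' = cls q"
  using assms
proof (induction w arbitrary: p)
  case Nil
  then show ?case using core_verts by auto
next
  case (Cons x w)
  then obtain p1 r where r: "cls p = cls p1" "edge_step \<Gamma> p1 x r" "walk \<Delta> (cls r) w (cls q)"
    by (auto simp: edge_step_quotient)
  have v: "p \<in> verts \<Gamma>" "p1 \<in> verts \<Gamma>" "r \<in> verts \<Gamma>" "q \<in> verts \<Gamma>"
    using r edge_step_verts Cons.prems core_verts by blast+
  then have p1: "p1 \<in> verts (core \<Gamma>)" "core_lang \<Gamma> p1 = core_lang \<Gamma> p"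
    using r(1) Cons.prems by (auto simp: cls_eq_iff)
  have w: "reduced w" "w = [] \<or> hd w \<noteq> bar x" using Cons.prems by (auto simp: reduced_Cons_iff)
  show ?case
  proof (cases "r \<in> verts (core \<Gamma>)")
    case True
    then have "edge_step (core \<Gamma>) p1 x r" using r p1 by (simp add: edge_step_core_iff)
    \<comment> \<open>The quotient edge comes from \<open>p1\<close>; the equal language at
      \<open>p\<close> provides a parallel edge there.\<close>
    then obtain s where s: "edge_step (core \<Gamma>) p x s" "core_lang \<Gamma> r = core_lang \<Gamma> s"
      using core_lang_step p1 by blast
    then have sv: "s \<in> verts (core \<Gamma>)" using core.edge_step_verts by blast
    then have "cls s = cls r" using s True v core_verts by (auto simp: cls_eq_iff)
    then obtain q' where "walk \<Gamma> s w q'" "cls q' = cls q"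
      using Cons.IH[OF sv] Cons.prems w r by auto
    then show ?thesis using s v by (auto simp: edge_step_core_iff)
  next
    case False
    then have t: "\<not> cyclically_reduced \<Gamma>" "r \<in> tail \<Gamma>" using not_coreD v by blast+
    then obtain z where
      z: "\<And>w q. reduced w \<Longrightarrow> walk \<Gamma> r w q \<Longrightarrow> w = [] \<or> hd w \<noteq> z \<Longrightarrow> q \<in> tail \<Gamma>"
      using tail_direction by meson
    have "p1 \<notin> tail \<Gamma>" using p1 t by (simp add: verts_core)
    \<comment> \<open>The edge just used, read backwards, leaves the tail, so its letter is the
      direction of the core; a reduced continuation cannot begin with it.\<close>
    then have "z = bar x" using z[of "[bar x]" p1] r(2) v by (auto simp: reduced_Cons_iff)
    then obtain q' where "q' \<in> tail \<Gamma>" "cls q = cls q'"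
      using lift_tail_walk[OF t, of z w "cls q"] z r(3) w by blast
    moreover have "q' \<notin> verts (core \<Gamma>)" using calculation t by (simp add: verts_core)
    ultimately have "q \<notin> verts (core \<Gamma>)"
      using cls_not_core[of q' q] v tail_verts by auto
    then show ?thesis using Cons.prems by blast
  qed
qed

section \<open>The loop group of the quotient and its index\<close>

definition loop_group :: "'a gword set" where
  "loop_group = {w \<in> carrier F. walk \<Delta> (base \<Delta>) w (base \<Delta>)}"

lemma subgroup_loop_group: "subgroup loop_group F"
proof (rule F.subgroupI)
  show "loop_group \<noteq> {}"
    using F.one_closed quot.base_verts by (auto simp: loop_group_def one_free_group intro!: exI[of _ "[]"])
qed (auto simp: loop_group_def intro: quot.walk_mult quot.walk_inv)

lemma H_subset_loop_group: "H \<subseteq> loop_group"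
  using walk_quotient by (auto simp: loop_group_def H_iff base_quotient)

lemma is_stallings_quotient: "is_stallings A loop_group \<Delta>"
proof -
  have "edges \<Delta> \<subseteq> verts \<Delta> \<times> A \<times> verts \<Delta>"
    using edges_subset by (auto simp: quotient_graph_def intro!: quotientI)
  then show ?thesis
    using quot.finite_verts quot.base_verts quot.connected quot.reduced_graph quot.degree_ge
    by (auto simp: is_stallings_def loop_group_def)
qed

lemma finite_index_loop_group:
  assumes "v \<in> verts (core \<Gamma>)"
  shows "finite_index F H loop_group"
proof -
  obtain t where t: "t \<in> carrier F" "walk \<Gamma> (base \<Gamma>) t v"
    using connected_carrier base_verts core_verts assms by blast
  \<comment> \<open>\<open>y k\<close> is \<open>k\<close> transported to the core vertex
    \<open>v\<close>, where lifting is possible, and \<open>e k\<close> is the end point of the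
    lift.\<close>
  define y where "y = (\<lambda>k. inv\<^bsub>F\<^esub> t \<otimes>\<^bsub>F\<^esub> k \<otimes>\<^bsub>F\<^esub> t)"
  define e where "e = (\<lambda>k. SOME q. walk \<Gamma> v (y k) q)"
  have y: "y k \<in> carrier F" if "k \<in> loop_group" for k using that t by (simp add: y_def loop_group_def)
  have e: "walk \<Gamma> v (y k) (e k)" if k: "k \<in> loop_group" for k
  proof -
    have "walk \<Delta> (cls (base \<Gamma>)) k (cls (base \<Gamma>))"
      using k by (simp add: loop_group_def base_quotient)
    then have "walk \<Delta> (cls v) (y k) (cls v)"
      unfolding y_def
      by (rule quot.walk_mult[OF quot.walk_mult[OF quot.walk_inv[OF t(1) walk_quotient[OF t(2)]]]
            walk_quotient[OF t(2)]])
    then have "\<exists>q. walk \<Gamma> v (y k) q"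
      using lift_core_walk[OF assms assms, of "y k"] y[OF k] unfolding carrier_free_group by blast
    then show ?thesis unfolding e_def by (rule someI_ex)
  qed
  show ?thesis
  proof (rule F.finite_indexI)
    show "finite (e ` loop_group)"
      by (rule finite_subset[OF _ finite_verts]) (use walk_target[OF e] in auto)
    fix a b assume ab: "a \<in> loop_group" "b \<in> loop_group" "e a = e b"
    have c: "a \<in> carrier F" "b \<in> carrier F" using ab by (auto simp: loop_group_def)
    \<comment> \<open>With a common end point, going out along one lift and back along the other
      closes up in the original graph.\<close>
    have "walk \<Gamma> v (y a \<otimes>\<^bsub>F\<^esub> inv\<^bsub>F\<^esub> (y b)) v"
      using walk_mult[OF e[OF ab(1)] walk_inv[OF y[OF ab(2)]]] e[OF ab(2)] ab(3) by simp
    then have "t \<otimes>\<^bsub>F\<^esub> (y a \<otimes>\<^bsub>F\<^esub> inv\<^bsub>F\<^esub> (y b)) \<otimes>\<^bsub>F\<^esub> inv\<^bsub>F\<^esub> t \<in> H"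
      using loop_iff[OF t] y ab by simp
    moreover have "t \<otimes>\<^bsub>F\<^esub> (y a \<otimes>\<^bsub>F\<^esub> inv\<^bsub>F\<^esub> (y b)) \<otimes>\<^bsub>F\<^esub> inv\<^bsub>F\<^esub> t = a \<otimes>\<^bsub>F\<^esub> inv\<^bsub>F\<^esub> b"
      using t c by (simp add: y_def F.m_assoc F.inv_mult_group F.inv_mult_cancel)
    ultimately show "a \<otimes>\<^bsub>F\<^esub> inv\<^bsub>F\<^esub> b \<in> H" by simp
  qed (rule subgroup_H subgroup_loop_group)+
qed

section \<open>Commensurating elements are loops of the quotient\<close>

lemma loop_conj_pow:
  assumes "a \<in> carrier F" "\<And>h. h \<in> H \<Longrightarrow> \<exists>n>0. a \<otimes>\<^bsub>F\<^esub> h [^]\<^bsub>F\<^esub> (n::nat) \<otimes>\<^bsub>F\<^esub> inv\<^bsub>F\<^esub> a \<in> H"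
    and t: "t \<in> carrier F" "walk \<Gamma> (base \<Gamma>) t v"
    and y: "y \<in> carrier F" "walk \<Gamma> v y v"
    and b: "b = inv\<^bsub>F\<^esub> t \<otimes>\<^bsub>F\<^esub> a \<otimes>\<^bsub>F\<^esub> t"
  shows "\<exists>n>0. \<forall>m. walk \<Gamma> v (b \<otimes>\<^bsub>F\<^esub> y [^]\<^bsub>F\<^esub> (n * m :: nat) \<otimes>\<^bsub>F\<^esub> inv\<^bsub>F\<^esub> b) v"
proof -
  have bc: "b \<in> carrier F" using assms by simp
  have "t \<otimes>\<^bsub>F\<^esub> y \<otimes>\<^bsub>F\<^esub> inv\<^bsub>F\<^esub> t \<in> H" using loop_iff t y by blast
  then obtain n :: nat where n: "n > 0"
    "a \<otimes>\<^bsub>F\<^esub> (t \<otimes>\<^bsub>F\<^esub> y \<otimes>\<^bsub>F\<^esub> inv\<^bsub>F\<^esub> t) [^]\<^bsub>F\<^esub> n \<otimes>\<^bsub>F\<^esub> inv\<^bsub>F\<^esub> a \<in> H"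
    using assms(2) by blast
  have "a \<otimes>\<^bsub>F\<^esub> (t \<otimes>\<^bsub>F\<^esub> y \<otimes>\<^bsub>F\<^esub> inv\<^bsub>F\<^esub> t) [^]\<^bsub>F\<^esub> n \<otimes>\<^bsub>F\<^esub> inv\<^bsub>F\<^esub> a =
      t \<otimes>\<^bsub>F\<^esub> (b \<otimes>\<^bsub>F\<^esub> y [^]\<^bsub>F\<^esub> n \<otimes>\<^bsub>F\<^esub> inv\<^bsub>F\<^esub> b) \<otimes>\<^bsub>F\<^esub> inv\<^bsub>F\<^esub> t"
    unfolding F.conj_pow[OF t(1) y(1)] using t y assms(1)
    by (simp add: b F.m_assoc F.inv_mult_group F.inv_mult_cancel)
  then have loop: "walk \<Gamma> v (b \<otimes>\<^bsub>F\<^esub> y [^]\<^bsub>F\<^esub> n \<otimes>\<^bsub>F\<^esub> inv\<^bsub>F\<^esub> b) v"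
    using n loop_iff[OF t] bc y by simp
  \<comment> \<open>Powers of a loop are loops, so all multiples of \<open>n\<close> are available;
    the factor \<open>m\<close> can then be taken as large as the cancellation estimate
    asks.\<close>
  have "walk \<Gamma> v (b \<otimes>\<^bsub>F\<^esub> y [^]\<^bsub>F\<^esub> (n * m) \<otimes>\<^bsub>F\<^esub> inv\<^bsub>F\<^esub> b) v" for m
    using walk_pow[OF loop, of A m] bc y by (simp add: F.conj_pow F.nat_pow_pow)
  then show ?thesis using n by blast
qed

lemma core_extend_loop:
  assumes "w \<in> core_lang \<Gamma> p"
  shows "\<exists>u c. prefix w u \<and> u \<in> carrier F \<and> c \<in> carrier F \<and> c \<noteq> [] \<and> reduced (u @ c) \<and>
    reduced (c @ c) \<and> walk \<Gamma> p (u \<otimes>\<^bsub>F\<^esub> c \<otimes>\<^bsub>F\<^esub> inv\<^bsub>F\<^esub> u) p"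
proof -
  obtain q where "walk (core \<Gamma>) p w q" "reduced w" using assms by (auto simp: core_lang_def)
  then obtain u c r where uc: "prefix w u" "c \<noteq> []" "reduced (u @ c)" "reduced (c @ c)"
    "walk (core \<Gamma>) p u r" "walk (core \<Gamma>) r c r"
    using core_walk_extend by blast
  then have w: "walk \<Gamma> p u r" "walk \<Gamma> r c r" using walk_coreD by auto
  then have c: "u \<in> carrier F" "c \<in> carrier F"
    using uc walk_carrier by (auto simp: reduced_append_iff)
  have "walk \<Gamma> p (u \<otimes>\<^bsub>F\<^esub> c \<otimes>\<^bsub>F\<^esub> inv\<^bsub>F\<^esub> u) p"
    using w c by (auto intro!: walk_mult walk_inv)
  then show ?thesis using uc c by blast
qed

text \<open>A high power has \<open>u\<close> as a prefix of its reduced form, and a reduced loop at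
  a core vertex stays in the core.\<close>

lemma core_lang_of_powers:
  assumes "p \<in> verts (core \<Gamma>)" "prefix w u" "u \<in> carrier F" "c \<in> carrier F" "c \<noteq> []"
    and "reduced (u @ c)" "reduced (c @ c)" "n > 0"
    and "\<And>m. walk \<Gamma> p ((u \<otimes>\<^bsub>F\<^esub> c \<otimes>\<^bsub>F\<^esub> inv\<^bsub>F\<^esub> u) [^]\<^bsub>F\<^esub> (n * m :: nat)) p"
  shows "w \<in> core_lang \<Gamma> p"
proof -
  let ?y = "u \<otimes>\<^bsub>F\<^esub> c \<otimes>\<^bsub>F\<^esub> inv\<^bsub>F\<^esub> u"
  obtain m where "prefix ([] @ u) ([] \<otimes>\<^bsub>F\<^esub> ?y [^]\<^bsub>F\<^esub> (n * m) \<otimes>\<^bsub>F\<^esub> [])"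
    using prefix_periodic[of "[]" A u c "[]" n] assms by (auto simp: carrier_free_group)
  moreover have y: "?y [^]\<^bsub>F\<^esub> (n * m) \<in> carrier F" using assms(3,4) by simp
  ultimately have "prefix u (?y [^]\<^bsub>F\<^esub> (n * m))"
    using F.l_one[OF y] F.r_one[OF y] by (simp add: one_free_group)
  then have "prefix w (?y [^]\<^bsub>F\<^esub> (n * m))"
    using assms(2) by (rule prefix_order.trans[rotated])
  then show ?thesis
    using y core_lang_prefix(2)[OF _ assms(9) assms(1) assms(1)] by (auto simp: carrier_free_group)
qed

lemma commensurator_subset_loop_group:
  assumes v: "v \<in> verts (core \<Gamma>)"
  shows "commensurator F H \<subseteq> loop_group"
proof
  fix g assume g: "g \<in> commensurator F H"
  then have gF: "g \<in> carrier F" by (simp add: commensurator_def)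
  obtain t where t: "t \<in> carrier F" "walk \<Gamma> (base \<Gamma>) t v"
    using connected_carrier base_verts core_verts v by blast
  define b where "b = inv\<^bsub>F\<^esub> t \<otimes>\<^bsub>F\<^esub> g \<otimes>\<^bsub>F\<^esub> t"
  have b: "b \<in> carrier F" using t gF by (simp add: b_def)
  have inv_b: "inv\<^bsub>F\<^esub> b = inv\<^bsub>F\<^esub> t \<otimes>\<^bsub>F\<^esub> inv\<^bsub>F\<^esub> g \<otimes>\<^bsub>F\<^esub> t"
    using t gF by (simp add: b_def F.inv_mult_group F.m_assoc)
  have pow: "\<exists>n>0. \<forall>m. walk \<Gamma> v (b \<otimes>\<^bsub>F\<^esub> y [^]\<^bsub>F\<^esub> (n * m :: nat) \<otimes>\<^bsub>F\<^esub> inv\<^bsub>F\<^esub> b) v"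
    if "y \<in> carrier F" "walk \<Gamma> v y v" for y
    by (rule loop_conj_pow[OF gF _ t that b_def]) (rule F.commensurator_pow(1)[OF subgroup_H g])
  have inv_pow: "\<exists>n>0. \<forall>m. walk \<Gamma> v (inv\<^bsub>F\<^esub> b \<otimes>\<^bsub>F\<^esub> y [^]\<^bsub>F\<^esub> (n * m :: nat) \<otimes>\<^bsub>F\<^esub> b) v"
    if "y \<in> carrier F" "walk \<Gamma> v y v" for y
    using loop_conj_pow[OF F.inv_closed[OF gF] _ t that inv_b]
      F.commensurator_pow(2)[OF subgroup_H g] gF b by simp
  have "\<exists>q. walk (core \<Gamma>) v b q"
  proof (cases "b = []")
    case True
    then show ?thesis using v by auto
  next
    case False
    \<comment> \<open>The first letter \<open>x\<close> of \<open>u\<close> must not cancel with the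
      end of \<open>b\<close>, so that \<open>b @ u\<close> is reduced and \<open>b\<close> survives
      as a prefix of a loop at \<open>v\<close>.\<close>
    obtain x p where "x \<noteq> bar (last b)" "edge_step (core \<Gamma>) v x p"
      using core_letter[OF v] by blast
    then have x: "x \<noteq> bar (last b)" "[x] \<in> core_lang \<Gamma> v"
      using core_langI[OF _ core.walk_single[THEN iffD2]] by (auto simp: reduced_Cons_iff)
    obtain u c where uc: "prefix [x] u" "u \<in> carrier F" "c \<in> carrier F" "c \<noteq> []"
      "reduced (u @ c)" "reduced (c @ c)" "walk \<Gamma> v (u \<otimes>\<^bsub>F\<^esub> c \<otimes>\<^bsub>F\<^esub> inv\<^bsub>F\<^esub> u) v"
      using core_extend_loop[OF x(2)] by blast
    let ?y = "u \<otimes>\<^bsub>F\<^esub> c \<otimes>\<^bsub>F\<^esub> inv\<^bsub>F\<^esub> u"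
    obtain n :: nat where
      n: "n > 0" "\<And>m. walk \<Gamma> v (b \<otimes>\<^bsub>F\<^esub> ?y [^]\<^bsub>F\<^esub> (n * m) \<otimes>\<^bsub>F\<^esub> inv\<^bsub>F\<^esub> b) v"
      using pow[OF _ uc(7)] uc by auto
    have "reduced (b @ u @ c)"
      using b x(1) uc(1,5) by (auto simp: carrier_free_group reduced_append_iff[of b] prefix_def)
    then obtain m where "prefix (b @ u) (b \<otimes>\<^bsub>F\<^esub> ?y [^]\<^bsub>F\<^esub> (n * m) \<otimes>\<^bsub>F\<^esub> inv\<^bsub>F\<^esub> b)"
      using prefix_periodic[OF b uc(2,3) F.inv_closed[OF b] _ uc(6,4) n(1)] by blast
    then have "prefix b (b \<otimes>\<^bsub>F\<^esub> ?y [^]\<^bsub>F\<^esub> (n * m) \<otimes>\<^bsub>F\<^esub> inv\<^bsub>F\<^esub> b)"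
      using append_prefixD by blast
    moreover have "b \<otimes>\<^bsub>F\<^esub> ?y [^]\<^bsub>F\<^esub> (n * m) \<otimes>\<^bsub>F\<^esub> inv\<^bsub>F\<^esub> b \<in> carrier F"
      using b uc by simp
    ultimately show ?thesis
      using core_lang_prefix(1)[OF _ n(2) v v] by (auto simp: carrier_free_group)
  qed
  then obtain q where bq_core: "walk (core \<Gamma>) v b q" by blast
  then have bq: "walk \<Gamma> v b q" and q: "q \<in> verts (core \<Gamma>)"
    using walk_coreD walk_target[OF bq_core] by auto
  \<comment> \<open>A loop at \<open>q\<close> becomes a loop at \<open>v\<close> by conjugation
    along the walk \<open>b\<close>; the power property of the inverse of \<open>b\<close> then
    shows that powers of the original element loop at \<open>v\<close> too.\<close>
  have "w \<in> core_lang \<Gamma> v" if w: "w \<in> core_lang \<Gamma> q" for w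
  proof -
    obtain u c where uc: "prefix w u" "u \<in> carrier F" "c \<in> carrier F" "c \<noteq> []"
      "reduced (u @ c)" "reduced (c @ c)" "walk \<Gamma> q (u \<otimes>\<^bsub>F\<^esub> c \<otimes>\<^bsub>F\<^esub> inv\<^bsub>F\<^esub> u) q"
      using core_extend_loop[OF w] by blast
    let ?y = "u \<otimes>\<^bsub>F\<^esub> c \<otimes>\<^bsub>F\<^esub> inv\<^bsub>F\<^esub> u"
    have y: "?y \<in> carrier F" using uc by simp
    have "walk \<Gamma> v (b \<otimes>\<^bsub>F\<^esub> ?y \<otimes>\<^bsub>F\<^esub> inv\<^bsub>F\<^esub> b) v"
      using bq b uc(7) by (auto intro!: walk_mult[of _ _ q] walk_inv)
    then obtain n :: nat where n: "n > 0"
      "\<And>m. walk \<Gamma> v (inv\<^bsub>F\<^esub> b \<otimes>\<^bsub>F\<^esub> (b \<otimes>\<^bsub>F\<^esub> ?y \<otimes>\<^bsub>F\<^esub> inv\<^bsub>F\<^esub> b) [^]\<^bsub>F\<^esub> (n * m) \<otimes>\<^bsub>F\<^esub> b) v"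
      using inv_pow[of "b \<otimes>\<^bsub>F\<^esub> ?y \<otimes>\<^bsub>F\<^esub> inv\<^bsub>F\<^esub> b"] b y by auto
    have "inv\<^bsub>F\<^esub> b \<otimes>\<^bsub>F\<^esub> (b \<otimes>\<^bsub>F\<^esub> ?y \<otimes>\<^bsub>F\<^esub> inv\<^bsub>F\<^esub> b) [^]\<^bsub>F\<^esub> k \<otimes>\<^bsub>F\<^esub> b = ?y [^]\<^bsub>F\<^esub> k" for k :: nat
      unfolding F.conj_pow[OF b y] using b F.nat_pow_closed[OF y, of k]
      by (simp add: F.m_assoc F.inv_mult_cancel del: F.nat_pow_closed)
    then show ?thesis
      using n by (intro core_lang_of_powers[OF v uc(1-6) n(1)]) simp
  qed
  \<comment> \<open>Here the conjugated powers loop at \<open>v\<close>, and going back along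
    \<open>b\<close> turns them into powers looping at \<open>q\<close>.\<close>
  moreover have "w \<in> core_lang \<Gamma> q" if w: "w \<in> core_lang \<Gamma> v" for w
  proof -
    obtain u c where uc: "prefix w u" "u \<in> carrier F" "c \<in> carrier F" "c \<noteq> []"
      "reduced (u @ c)" "reduced (c @ c)" "walk \<Gamma> v (u \<otimes>\<^bsub>F\<^esub> c \<otimes>\<^bsub>F\<^esub> inv\<^bsub>F\<^esub> u) v"
      using core_extend_loop[OF w] by blast
    let ?y = "u \<otimes>\<^bsub>F\<^esub> c \<otimes>\<^bsub>F\<^esub> inv\<^bsub>F\<^esub> u"
    have y: "?y \<in> carrier F" using uc by simp
    obtain n :: nat where n: "n > 0"
      "\<And>m. walk \<Gamma> v (b \<otimes>\<^bsub>F\<^esub> ?y [^]\<^bsub>F\<^esub> (n * m) \<otimes>\<^bsub>F\<^esub> inv\<^bsub>F\<^esub> b) v"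
      using pow[OF y uc(7)] by auto
    have "walk \<Gamma> q (?y [^]\<^bsub>F\<^esub> (n * m)) q" for m
    proof -
      have "walk \<Gamma> q (inv\<^bsub>F\<^esub> b \<otimes>\<^bsub>F\<^esub> (b \<otimes>\<^bsub>F\<^esub> ?y [^]\<^bsub>F\<^esub> (n * m) \<otimes>\<^bsub>F\<^esub> inv\<^bsub>F\<^esub> b) \<otimes>\<^bsub>F\<^esub> b) q"
        by (rule walk_mult[OF walk_mult[OF walk_inv[OF b bq] n(2)] bq])
      moreover have "inv\<^bsub>F\<^esub> b \<otimes>\<^bsub>F\<^esub> (b \<otimes>\<^bsub>F\<^esub> ?y [^]\<^bsub>F\<^esub> (n * m) \<otimes>\<^bsub>F\<^esub> inv\<^bsub>F\<^esub> b) \<otimes>\<^bsub>F\<^esub> b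
          = ?y [^]\<^bsub>F\<^esub> (n * m)"
        using b F.nat_pow_closed[OF y, of "n * m"]
        by (simp add: F.m_assoc F.inv_mult_cancel del: F.nat_pow_closed)
      ultimately show ?thesis by simp
    qed
    then show ?thesis by (rule core_lang_of_powers[OF q uc(1-6) n(1)])
  qed
  ultimately have "cls q = cls v"
    using q v core_verts by (subst cls_eq_iff) auto
  then have "walk \<Delta> (cls v) b (cls v)" using walk_quotient[OF bq] by simp
  then have "walk \<Delta> (base \<Delta>) (t \<otimes>\<^bsub>F\<^esub> b \<otimes>\<^bsub>F\<^esub> inv\<^bsub>F\<^esub> t) (base \<Delta>)"
    using walk_quotient[OF t(2)] t(1) unfolding base_quotient
    by (auto intro!: quot.walk_mult quot.walk_inv)
  moreover have "t \<otimes>\<^bsub>F\<^esub> b \<otimes>\<^bsub>F\<^esub> inv\<^bsub>F\<^esub> t = g"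
    using t gF by (simp add: b_def F.m_assoc F.inv_mult_cancel)
  ultimately show "g \<in> loop_group" using gF by (simp add: loop_group_def)
qed

text \<open>With all vertices in the tail, the reduced loops \<open>h\<close> and
  \<open>winv h\<close> at the base are comparable and equally long, hence equal. So
  \<open>h\<close> squared is trivial, and torsion-freeness applies.\<close>

lemma core_empty_trivial:
  assumes "verts (core \<Gamma>) = {}"
  shows "H = {\<one>\<^bsub>F\<^esub>}" "loop_group = {\<one>\<^bsub>F\<^esub>}"
proof -
  have t: "\<not> cyclically_reduced \<Gamma>" "\<And>p. p \<in> verts \<Gamma> \<Longrightarrow> p \<in> tail \<Gamma>"
    using assms base_verts by (auto simp: verts_core split: if_splits)
  have "h = \<one>\<^bsub>F\<^esub>" if h: "h \<in> H" for h
  proof -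
    have hF: "h \<in> carrier F" "walk \<Gamma> (base \<Gamma>) h (base \<Gamma>)" using h by (auto simp: H_iff)
    then have "prefix h (winv h) \<or> prefix (winv h) h"
      using t(2)[OF walk_target] unfolding carrier_free_group
      by (intro tail_walks_comparable[OF t(1) _ _ hF(2) walk_winv[OF hF(2)]]) auto
    then have "winv h = h"
      by (metis prefix_length_less strict_prefix_def length_winv less_irrefl)
    then have "h [^]\<^bsub>F\<^esub> (2::nat) = \<one>\<^bsub>F\<^esub>"
      using hF F.r_inv[OF hF(1)] by (simp add: numeral_2_eq_2 inv_free_group)
    then show ?thesis using free_group_torsion_free hF by (metis zero_less_numeral)
  qed
  then show H: "H = {\<one>\<^bsub>F\<^esub>}" using subgroup.one_closed[OF subgroup_H] by blast
  \<comment> \<open>Without core vertices all classes are singletons, so quotient walks are walks of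
    the original graph.\<close>
  have lift: "walk \<Gamma> p w q" if "walk \<Delta> (cls p) w (cls q)" "p \<in> verts \<Gamma>" "q \<in> verts \<Gamma>" for p w q
    using that
  proof (induction w arbitrary: p)
    case Nil
    then show ?case using assms by (auto simp: cls_eq_iff)
  next
    case (Cons x w)
    then obtain p1 r where r: "cls p = cls p1" "edge_step \<Gamma> p1 x r" "walk \<Delta> (cls r) w (cls q)"
      by (auto simp: edge_step_quotient)
    then have "p1 = p" using assms Cons.prems edge_step_verts by (auto simp: cls_eq_iff)
    then show ?case using r Cons edge_step_verts by auto
  qed
  have "loop_group \<subseteq> H"
    using lift base_verts by (auto simp: loop_group_def H_iff base_quotient)
  then show "loop_group = {\<one>\<^bsub>F\<^esub>}" using H H_subset_loop_group by blast
qed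

theorem loop_group_max_fi_extension:
  shows "fi_extension F H loop_group" and "fi_extension F H L \<Longrightarrow> L \<subseteq> loop_group"
    and "H \<noteq> {\<one>\<^bsub>F\<^esub>} \<Longrightarrow> loop_group = commensurator F H"
proof -
  have fi: "fi_extension F H loop_group \<and> (\<forall>L. fi_extension F H L \<longrightarrow> L \<subseteq> loop_group) \<and>
    (H \<noteq> {\<one>\<^bsub>F\<^esub>} \<longrightarrow> loop_group = commensurator F H)"
  proof (cases "verts (core \<Gamma>) = {}")
    case True
    have "L \<subseteq> loop_group" if L: "fi_extension F H L" for L
    proof
      \<comment> \<open>Some positive power of \<open>g\<close> lies in the trivial group
        \<open>H\<close>, so \<open>g\<close> is trivial.\<close>
      fix g assume "g \<in> L"
      then obtain n :: nat where "n > 0" "g [^]\<^bsub>F\<^esub> n \<in> H" "g \<in> carrier F"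
        using F.finite_index_pow[OF _ subgroup_H, of L g] L subgroup.mem_carrier[of L F g]
        by (auto simp: fi_extension_def)
      then show "g \<in> loop_group"
        using free_group_torsion_free core_empty_trivial[OF True] by auto
    qed
    moreover have "finite_index F H loop_group"
      unfolding core_empty_trivial[OF True]
      by (rule F.finite_indexI[where f = id]) (auto intro: F.triv_subgroup)
    ultimately show ?thesis
      using subgroup_loop_group H_subset_loop_group core_empty_trivial[OF True] by (auto simp: fi_extension_def)
  next
    case False
    then obtain v where v: "v \<in> verts (core \<Gamma>)" by blast
    have "fi_extension F H loop_group"
      using subgroup_loop_group H_subset_loop_group finite_index_loop_group[OF v] by (simp add: fi_extension_def)
    \<comment> \<open>Every finite-index extension lies in the commensurator and hence in the loop
      group; the loop group is itself such an extension, which gives equality.\<close>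
    then show ?thesis
      using F.fi_extension_subset_commensurator[OF _ subgroup_H] commensurator_subset_loop_group[OF v]
      by blast
  qed
  show "fi_extension F H loop_group" and "fi_extension F H L \<Longrightarrow> L \<subseteq> loop_group"
    and "H \<noteq> {\<one>\<^bsub>F\<^esub>} \<Longrightarrow> loop_group = commensurator F H"
    using fi by auto
qed

lemma max_fi_extension_eq_loop_group: "max_fi_extension F H = loop_group"
  unfolding max_fi_extension_def
  by (rule Greatest_equality) (use loop_group_max_fi_extension in auto)

end

theorem theorem2p10:
  fixes A :: "'a set" and H :: "'a gword set"
  assumes "finite A"
    and "subgroup H (free_group A)"
    and "finitely_generated (free_group A) H"
  shows
    "(fi_extension (free_group A) H (max_fi_extension (free_group A) H) \<and>
      (\<forall>K. fi_extension (free_group A) H K \<longrightarrow> K \<subseteq> max_fi_extension (free_group A) H)) \<and>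
     (\<forall>\<Gamma> :: ('v, 'a) pointed_lgraph. is_stallings A H \<Gamma> \<longrightarrow>
        reduced_graph (quotient_graph \<Gamma> (core_equiv \<Gamma>)) \<and>
        is_stallings A (max_fi_extension (free_group A) H) (quotient_graph \<Gamma> (core_equiv \<Gamma>))) \<and>
     (H \<noteq> {\<one>\<^bsub>free_group A\<^esub>} \<or> A = {} \<longrightarrow>
        max_fi_extension (free_group A) H = commensurator (free_group A) H)"
proof -
  interpret free_subgroup A H using assms(2) by (rule free_subgroup.intro)
  \<comment> \<open>The type \<open>'v\<close> may be too small to carry a graph of
    \<open>H\<close>; the claims that do not mention a graph are read off one on cosets.\<close>
  interpret S: stallings_graph A H "schreier_core A H"
    using assms is_stallings_schreier_core free_subgroup_axioms
    by (intro stallings_graph.intro stallings_graph_axioms.intro)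
  note max = S.loop_group_max_fi_extension[folded S.max_fi_extension_eq_loop_group]
  have "reduced_graph (quotient_graph \<Gamma> (core_equiv \<Gamma>)) \<and>
        is_stallings A (max_fi_extension (free_group A) H) (quotient_graph \<Gamma> (core_equiv \<Gamma>))"
    if "is_stallings A H \<Gamma>" for \<Gamma> :: "('v, 'a) pointed_lgraph"
  proof -
    interpret T: stallings_graph A H \<Gamma>
      using assms(1) that free_subgroup_axioms
      by (intro stallings_graph.intro stallings_graph_axioms.intro)
    show ?thesis
      using T.quot.reduced_graph T.is_stallings_quotient by (simp add: T.max_fi_extension_eq_loop_group)
  qed
  \<comment> \<open>Over the empty basis the free group is trivial, so both sides consist of the
    empty word.\<close>
  moreover have "max_fi_extension (free_group A) H = commensurator (free_group A) H" if "A = {}"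
  proof -
    have "A <+> A = {}" using that by (simp only: Plus_eq_empty_conv)
    then have lists: "lists (A <+> A) = {[]}" by (simp only: lists_empty)
    have "carrier (free_group A) \<subseteq> {[]}"
      unfolding subset_iff carrier_free_group lists by blast
    moreover have "max_fi_extension (free_group A) H \<subseteq> commensurator (free_group A) H"
      using F.fi_extension_subset_commensurator max(1) assms(2) by blast
    moreover have "commensurator (free_group A) H \<subseteq> carrier (free_group A)"
      by (auto simp: commensurator_def)
    moreover have "[] \<in> max_fi_extension (free_group A) H"
      using max(1) subgroup.one_closed unfolding fi_extension_def one_free_group[of A, symmetric]
      by blast
    ultimately show ?thesis by blast
  qed
  ultimately show ?thesis using max by blast
qed

end
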